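(* Let $\mu$ be a geodesic current on $X$, and let $$\delta_\mu=\sup_{B\in\mathcal B}\min\{\mu(B),\mu(B^\perp)\}.$$ Then the dual space $X_\mu$ is a $\delta_\mu$-hyperbolic space, and $\delta_\mu$ is the optimal hyperbolicity constant (i.e. the smallest $\delta$ such that $X_\mu$ is $\delta$-hyperbolic).
   Context: $X$ is a closed connected orientable hyperbolic surface with universal cover $\widetilde X$ (the hyperbolic plane), $\pi_1(X)$ acts on $\widetilde X$ by deck transformations, and $\partial\widetilde X$ is the boundary circle at infinity. $\mathcal G(\widetilde X)=\{(x,y)\in(\partial\widetilde X)^2: x\ne y\}/\big((x,y)\sim(y,x)\big)$ is the space of unoriented bi-infinite geodesics of $\widetilde X$. A geodesic current on $X$ is a positive $\pi_1(X)$-invariant locally finite Radon measure on $\mathcal G(\widetilde X)$. Dual space: for a geodesic segment $\tau\subset\widetilde X$ (containing or omitting its endpoints, possibly degenerate), $G(\tau)$ is the set of geodesics $\gamma\in\mathcal G(\widetilde X)$ intersecting $\tau$ transversely, i.e. $\gamma\cap\tau$ is a single point; write $G[\bar x,\bar y)$ for $G([\bar x,\bar y))$, etc. The current $\mu$ induces the pseudo-distance on $\widetilde X$ $$d_\mu(\bar x,\bar y)=\tfrac12\{\mu(G[\bar x,\bar y))+\mu(G(\bar x,\bar y])\}.$$ The dual space $X_\mu$ is the metric quotient of $(\widetilde X,d_\mu)$, obtained by identifying $\bar x,\bar y$ whenever $d_\mu(\bar x,\bar y)=0$, with the induced metric, again denoted $d_\mu$. Boxes: $I_{a,b}$ denotes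 any of the non-empty (possibly degenerate) intervals of $\partial\widetilde X$ with endpoints $a,b$ in counter-clockwise order, open, closed or half-open. A box of geodesics is a subset $B=I_{a,b}\times I_{c,d}$ of $\mathcal G(\widetilde X)$ ($a,b,c,d$ in counter-clockwise order), and $\mathcal B$ is the family of all boxes. The opposite box is $B^\perp=I_{d,a}\times I_{b,c}$, where $I_{d,a},I_{b,c}$ are the complementary intervals, so that $I_{a,b},I_{b,c},I_{c,d},I_{d,a}$ partition $\partial\widetilde X$. Hyperbolicity: a metric space $(Y,d)$ is $\delta$-hyperbolic if for any $x,y,z,w\in Y$, among the three quantities $d(x,y)+d(z,w)$, $d(x,z)+d(y,w)$, $d(y,z)+d(x,w)$, the two largest are within $2\delta$ of each other. *)

theory Defs
  imports "HOL-Analysis.Analysis" "HOL-Library.Uprod"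
begin

section \<open>The hyperbolic plane\<close>

text \<open>
  The hyperbolic plane is taken in the Beltrami--Klein model: the points are those of the open unit
  disc, the circle at infinity is the unit circle, and the complete geodesics are the open chords.
  The distance is normalised to curvature -1.
\<close>

abbreviation hyp_plane :: "complex set"
  where "hyp_plane \<equiv> ball 0 1"

abbreviation hyp_boundary :: "complex set"
  where "hyp_boundary \<equiv> sphere 0 1"

definition hyp_dist :: "complex \<Rightarrow> complex \<Rightarrow> real" where
  "hyp_dist x y =
     arcosh ((1 - inner x y) / (sqrt (1 - (norm x)\<^sup>2) * sqrt (1 - (norm y)\<^sup>2)))"

definition hyp_segment :: "complex \<Rightarrow> complex \<Rightarrow> complex set" where
  "hyp_segment x y = {z \<in> hyp_plane. hyp_dist x z + hyp_dist z y = hyp_dist x y}"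

lemma klein_form_ge:
  fixes x y :: complex
  assumes "norm x < 1" "norm y < 1"
  shows "(1 - inner x y)\<^sup>2 \<ge> (1 - (norm x)\<^sup>2) * (1 - (norm y)\<^sup>2)" "1 - inner x y > 0"
proof -
  obtain a b where x: "x = Complex a b" by (cases x)
  obtain c d where y: "y = Complex c d" by (cases y)
  have nx: "a^2 + b^2 < 1" using assms(1) by (simp add: x norm_complex_def abs_square_less_1 power2_eq_square)
  have e: "(1 - inner x y)\<^sup>2 - (1 - (norm x)\<^sup>2) * (1 - (norm y)\<^sup>2)
     = (1 - (a^2+b^2)) * ((a-c)^2 + (b-d)^2) + (a*(c-a) + b*(d-b))^2"
    by (simp add: x y norm_complex_def inner_complex_def) algebra
  have "0 \<le> (1 - (a^2+b^2)) * ((a-c)^2 + (b-d)^2)"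
    using nx by (intro mult_nonneg_nonneg) auto
  then show "(1 - inner x y)\<^sup>2 \<ge> (1 - (norm x)\<^sup>2) * (1 - (norm y)\<^sup>2)"
    using e zero_le_power2[of "a*(c-a) + b*(d-b)"] by linarith
  have "inner x y \<le> norm x * norm y" by (rule norm_cauchy_schwarz)
  also have "\<dots> < 1" using assms by (metis norm_ge_zero mult_1 mult_strict_mono')
  finally show "1 - inner x y > 0" by simp
qed

lemma hyp_dist_props:
  assumes "norm x < 1" "norm y < 1"
  shows "cosh (hyp_dist x y) = (1 - inner x y) / sqrt ((1 - (norm x)\<^sup>2) * (1 - (norm y)\<^sup>2))"
    and "sinh (hyp_dist x y) = sqrt ((1 - inner x y)\<^sup>2 - (1 - (norm x)\<^sup>2) * (1 - (norm y)\<^sup>2))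
        / sqrt ((1 - (norm x)\<^sup>2) * (1 - (norm y)\<^sup>2))"
    and "0 \<le> hyp_dist x y"
proof -
  let ?p = "1 - inner x y" and ?m = "(1 - (norm x)\<^sup>2) * (1 - (norm y)\<^sup>2)"
  have m: "?m > 0" using assms by (simp add: abs_square_less_1)
  have p: "?p > 0" "?p\<^sup>2 \<ge> ?m" using klein_form_ge[OF assms] by auto
  have "sqrt ?m \<le> ?p" using p by (simp add: real_le_lsqrt)
  then have ge: "?p / sqrt ?m \<ge> 1" using m by (simp add: divide_simps del: real_sqrt_mult)
  have d: "hyp_dist x y = arcosh (?p / sqrt ?m)"
    by (simp add: hyp_dist_def real_sqrt_mult)
  show "cosh (hyp_dist x y) = ?p / sqrt ?m" "0 \<le> hyp_dist x y"
    unfolding d using ge by simp_all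
  have "(a / sqrt b)\<^sup>2 - 1 = (a\<^sup>2 - b) / b" if "b > 0" for a b :: real
    using that by (simp add: power_divide diff_divide_distrib)
  then have "(?p / sqrt ?m)\<^sup>2 - 1 = (?p\<^sup>2 - ?m) / ?m"
    using m by blast
  then show "sinh (hyp_dist x y) = sqrt (?p\<^sup>2 - ?m) / sqrt ?m"
    unfolding d sinh_arcosh_real[OF ge] by (simp only: real_sqrt_divide)
qed

lemma hyp_dist_add_iff:
  assumes "norm x < 1" "norm y < 1" "norm z < 1"
  shows "hyp_dist x z + hyp_dist z y = hyp_dist x y \<longleftrightarrow> z \<in> closed_segment x y"
proof -
  define A where "A = 1 - (norm x)\<^sup>2"
  define B where "B = 1 - (norm y)\<^sup>2"
  define C where "C = 1 - (norm z)\<^sup>2"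
  define p where "p = 1 - inner x y"
  define q where "q = 1 - inner z y"
  define r where "r = 1 - inner x z"
  have pos: "A > 0" "B > 0" "C > 0" using assms by (auto simp: A_def B_def C_def abs_square_less_1)
  have ge: "r\<^sup>2 \<ge> A * C" "q\<^sup>2 \<ge> C * B"
    using klein_form_ge[of x z] klein_form_ge[of z y] assms by (auto simp: A_def B_def C_def q_def r_def)
  have "hyp_dist x z + hyp_dist z y = hyp_dist x y \<longleftrightarrow>
     cosh (hyp_dist x z + hyp_dist z y) = cosh (hyp_dist x y)"
    using hyp_dist_props(3) assms by (metis add_nonneg_nonneg arcosh_cosh_real)
  also have "\<dots> \<longleftrightarrow> (r / sqrt (A*C)) * (q / sqrt (C*B)) +
      (sqrt (r\<^sup>2 - A*C) / sqrt (A*C)) * (sqrt (q\<^sup>2 - C*B) / sqrt (C*B)) = p / sqrt (A * B)"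
    by (simp only: cosh_add hyp_dist_props[OF assms(1,3)] hyp_dist_props[OF assms(3,2)]
      hyp_dist_props[OF assms(1,2)] A_def B_def C_def p_def q_def r_def)
  also have "\<dots> \<longleftrightarrow> (r * q + sqrt (r\<^sup>2 - A*C) * sqrt (q\<^sup>2 - C*B)) / (C * sqrt (A*B)) = (p * C) / (C * sqrt (A * B))"
  proof -
    have "sqrt (A*C) * sqrt (C*B) = C * sqrt (A*B)"
      using pos by (simp add: real_sqrt_mult)
    then show ?thesis using pos by (simp add: add_divide_distrib)
  qed
  also have "\<dots> \<longleftrightarrow> sqrt ((r\<^sup>2 - A*C) * (q\<^sup>2 - C*B)) = p * C - r * q"
  proof -
    have "C * sqrt (A * B) \<noteq> 0" using pos by simp
    then have eq: "a / (C * sqrt (A * B)) = b / (C * sqrt (A * B)) \<longleftrightarrow> a = b" for a b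
      by (metis nonzero_mult_div_cancel_right times_divide_eq_left)
    show ?thesis
      unfolding eq real_sqrt_mult[of "r\<^sup>2 - A*C" "q\<^sup>2 - C*B"] by linarith
  qed
  also have "\<dots> \<longleftrightarrow> p * C - r * q \<ge> 0 \<and> (r\<^sup>2 - A*C) * (q\<^sup>2 - C*B) = (p * C - r * q)\<^sup>2"
    by (metis ge diff_ge_0_iff_ge mult_nonneg_nonneg real_sqrt_ge_zero real_sqrt_pow2 real_sqrt_unique)
  also have "\<dots> \<longleftrightarrow> z \<in> closed_segment x y"
  proof -
    define u where "u = x - z" define v where "v = y - z"
    have xy: "x = z + u" "y = z + v" by (auto simp: u_def v_def)
    obtain z1 z2 where zz: "z = Complex z1 z2" by (cases z)
    obtain u1 u2 where uu: "u = Complex u1 u2" by (cases u)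
    obtain v1 v2 where vv: "v = Complex v1 v2" by (cases v)
    note cs = A_def B_def C_def p_def q_def r_def xy zz uu vv inner_complex_def norm_complex_def
    have e1: "p * C - r * q = - (C * (u1 * v1+u2 * v2) + (z1*u1+z2*u2)*(z1 * v1+z2 * v2))"
      by (simp add: cs) algebra
    have e2: "(r\<^sup>2 - A*C) * (q\<^sup>2 - C*B) - (p * C - r * q)\<^sup>2 = C * (u1 * v2-u2 * v1)\<^sup>2"
      by (simp add: cs) algebra
    have zseg: "z \<in> closed_segment x y \<longleftrightarrow> 0 \<in> closed_segment u v"
      using closed_segment_translation_eq[of z 0 u v] by (simp add: xy)
    show ?thesis
    proof
      assume L: "p * C - r * q \<ge> 0 \<and> (r\<^sup>2 - A*C) * (q\<^sup>2 - C*B) = (p * C - r * q)\<^sup>2"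
      then have det: "u1 * v2 = u2 * v1" using e2 pos by simp
      have ip: "C * (u1 * v1+u2 * v2) + (z1*u1+z2*u2)*(z1 * v1+z2 * v2) \<le> 0" using L e1 by simp
      show "z \<in> closed_segment x y" unfolding zseg
      proof (cases "u = 0")
        case False
        define k where "k = (u1 * v1+u2 * v2) / (u1^2+u2^2)"
        have un: "u1^2+u2^2 > 0" using False by (simp add: uu complex_eq_iff sum_power2_gt_zero_iff)
        have k1: "v1 * (u1^2+u2^2) = (u1 * v1+u2 * v2)*u1" "v2 * (u1^2+u2^2) = (u1 * v1+u2 * v2)*u2"
          using det by algebra+
        have k: "v1 = k * u1" "v2 = k * u2"
          unfolding k_def times_divide_eq_left using un k1 by (simp_all only: nonzero_eq_divide_eq less_imp_neq[symmetric] not_False_eq_True simp_thms)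
        have "k * (C * (u1^2+u2^2) + (z1*u1+z2*u2)^2) \<le> 0"
          using ip unfolding k by (simp add: algebra_simps power2_eq_square)
        moreover have "C * (u1^2+u2^2) + (z1*u1+z2*u2)^2 > 0"
          using pos un by (simp add: add_pos_nonneg)
        ultimately have k0: "k \<le> 0" by (simp add: mult_le_0_iff)
        have "v = k *\<^sub>R u" by (simp add: uu vv k complex_eq_iff)
        moreover have "(1 - 1/(1-k)) + 1/(1-k) * k = 0"
          using k0 by (simp add: field_simps)
        ultimately have "0 = (1 - 1/(1-k)) *\<^sub>R u + (1/(1-k)) *\<^sub>R v"
          unfolding \<open>v = k *\<^sub>R u\<close> scaleR_scaleR scaleR_left_distrib[symmetric] by simp
        moreover have "0 \<le> 1/(1-k)" "1/(1-k) \<le> 1" using k0 by auto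
        ultimately have "0 \<le> 1/(1-k) \<and> 1/(1-k) \<le> 1 \<and> 0 = (1 - 1/(1-k)) *\<^sub>R u + (1/(1-k)) *\<^sub>R v"
          by (intro conjI)
        then show "0 \<in> closed_segment u v"
          unfolding in_segment by (rule exI)
      qed simp
    next
      assume "z \<in> closed_segment x y"
      then have "0 \<in> closed_segment u v" by (rule zseg[THEN iffD1])
      then have "\<exists>t. 0 \<le> t \<and> t \<le> 1 \<and> 0 = (1 - t) *\<^sub>R u + t *\<^sub>R v"
        unfolding in_segment .
      then obtain t where t: "0 \<le> t" "t \<le> 1" "0 = (1 - t) *\<^sub>R u + t *\<^sub>R v"
        by (elim exE conjE)
      then have h: "(1-t)*u1 + t * v1 = 0" "(1-t)*u2 + t * v2 = 0" by (auto simp: uu vv complex_eq_iff)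
      have det: "u1 * v2 = u2 * v1"
      proof (cases "t = 0")
        case False
        have "t * (u1 * v2 - u2 * v1) = 0" using h by algebra
        then show ?thesis using False by simp
      qed (use h in auto)
      have Q: "C * (a^2+b^2) + (z1*a+z2*b)^2 \<ge> 0" for a b using pos by simp
      have "C * (u1 * v1+u2 * v2) + (z1*u1+z2*u2)*(z1 * v1+z2 * v2) \<le> 0" (is "?I \<le> 0")
      proof (cases "t = 0")
        case True
        then show ?thesis using h by simp
      next
        case False
        have "t * ?I = C * (u1 * (t * v1) + u2 * (t * v2)) + (z1*u1+z2*u2) * (z1 * (t * v1) + z2 * (t * v2))"
          by (simp add: algebra_simps)
        also have "t * v1 = - ((1-t)*u1)" using h(1) by linarith
        also have "t * v2 = - ((1-t)*u2)" using h(2) by linarith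
        also have "C * (u1 * - ((1-t)*u1) + u2 * - ((1-t)*u2)) +
            (z1*u1+z2*u2) * (z1 * - ((1-t)*u1) + z2 * - ((1-t)*u2)) =
            - ((1-t) * (C * (u1^2+u2^2) + (z1*u1+z2*u2)^2))"
          by (simp add: algebra_simps power2_eq_square)
        also have "\<dots> \<le> 0" using Q t(2) by simp
        finally show ?thesis using False t(1) by (simp add: mult_le_0_iff)
      qed
      then show "p * C - r * q \<ge> 0 \<and> (r\<^sup>2 - A*C) * (q\<^sup>2 - C*B) = (p * C - r * q)\<^sup>2"
        using e1 e2 det by simp
    qed
  qed
  finally show ?thesis .
qed

text \<open>Metric segments are Euclidean ones, in accordance with chords being the complete geodesics.\<close>

lemma hyp_segment_eq_closed_segment:
  assumes "x \<in> hyp_plane" "y \<in> hyp_plane"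
  shows "hyp_segment x y = closed_segment x y"
proof -
  have "closed_segment x y \<subseteq> hyp_plane"
    using assms by (simp add: closed_segment_subset)
  moreover have "norm x < 1" "norm y < 1" using assms by auto
  ultimately show ?thesis
    using hyp_dist_add_iff[of x y] by (force simp: hyp_segment_def)
qed

definition ccw :: "complex \<Rightarrow> complex \<Rightarrow> complex \<Rightarrow> bool" where
  "ccw u v w \<longleftrightarrow> 0 < Im (cnj (v - u) * (w - u))"

text \<open>
  An isometry of the plane is regarded together with its continuous extension to the closed disc;
  setting it to be the identity outside the closed disc makes the extension unique as a function,
  so that composition and inverse of isometries are those of HOL functions.
\<close>

definition orientation_preserving_isometry :: "(complex \<Rightarrow> complex) \<Rightarrow> bool" where
  "orientation_preserving_isometry g \<longleftrightarrow>
     g ` hyp_plane = hyp_plane \<and>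
     (\<forall>x\<in>hyp_plane. \<forall>y\<in>hyp_plane. hyp_dist (g x) (g y) = hyp_dist x y) \<and>
     continuous_on (cball 0 1) g \<and>
     (\<forall>x. x \<notin> cball 0 1 \<longrightarrow> g x = x) \<and>
     (\<forall>u\<in>cball 0 1. \<forall>v\<in>cball 0 1. \<forall>w\<in>cball 0 1. ccw u v w \<longrightarrow> ccw (g u) (g v) (g w))"

text \<open>
  A closed connected orientable hyperbolic surface, given as the quotient of its universal cover,
  the hyperbolic plane, by the group \<open>\<Gamma>\<close> of deck transformations: orientation-preserving isometries
  forming a covering space action with compact quotient.
\<close>

locale closed_hyperbolic_surface =
  fixes \<Gamma> :: "(complex \<Rightarrow> complex) set"
  assumes isometries: "g \<in> \<Gamma> \<Longrightarrow> orientation_preserving_isometry g"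
    and id_mem: "id \<in> \<Gamma>"
    and comp_mem: "g \<in> \<Gamma> \<Longrightarrow> h \<in> \<Gamma> \<Longrightarrow> g \<circ> h \<in> \<Gamma>"
    and inv_mem: "g \<in> \<Gamma> \<Longrightarrow> inv g \<in> \<Gamma>"
    and covering_action: "x \<in> hyp_plane \<Longrightarrow>
      \<exists>U\<subseteq>hyp_plane. open U \<and> x \<in> U \<and> (\<forall>g\<in>\<Gamma>. g ` U \<inter> U \<noteq> {} \<longrightarrow> g = id)"
    and cocompact: "\<exists>K\<subseteq>hyp_plane. compact K \<and> (\<Union>g\<in>\<Gamma>. g ` K) = hyp_plane"

section \<open>Geodesics and geodesic currents\<close>

definition geodesics :: "complex uprod set" where
  "geodesics = {Upair u v |u v. u \<in> hyp_boundary \<and> v \<in> hyp_boundary \<and> u \<noteq> v}"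

definition ordered_geodesics :: "(complex \<times> complex) set" where
  "ordered_geodesics = {(u, v). u \<in> hyp_boundary \<and> v \<in> hyp_boundary \<and> u \<noteq> v}"

text \<open>The quotient topology with respect to the map \<open>(u, v) \<mapsto> Upair u v\<close>.\<close>

definition geodesic_topology :: "complex uprod topology" where
  "geodesic_topology = topology (\<lambda>U. U \<subseteq> geodesics \<and>
     openin (top_of_set ordered_geodesics) {(u, v) \<in> ordered_geodesics. Upair u v \<in> U})"

lemma openin_geodesic_topology:
  "openin geodesic_topology U \<longleftrightarrow> U \<subseteq> geodesics \<and>
     openin (top_of_set ordered_geodesics) {(u, v) \<in> ordered_geodesics. Upair u v \<in> U}"
proof -
  let ?P = "\<lambda>U. {(u, v) \<in> ordered_geodesics. Upair u v \<in> U}"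
  have 1: "?P (S \<inter> T) = ?P S \<inter> ?P T" for S T
    by auto
  have 2: "?P (\<Union>\<K>) = (\<Union>K\<in>\<K>. ?P K)" for \<K>
    by auto
  have "istopology (\<lambda>U. U \<subseteq> geodesics \<and> openin (top_of_set ordered_geodesics) (?P U))"
    unfolding istopology_def 1 2 by (blast intro: openin_Int openin_Union)
  then show ?thesis
    unfolding geodesic_topology_def by (simp add: topology_inverse')
qed

lemma topspace_geodesic_topology: "topspace geodesic_topology = geodesics"
proof
  show "topspace geodesic_topology \<subseteq> geodesics"
    using openin_geodesic_topology openin_topspace by blast
  have "{(u, v) \<in> ordered_geodesics. Upair u v \<in> geodesics} = ordered_geodesics"
    by (auto simp: ordered_geodesics_def geodesics_def)
  then have "openin geodesic_topology geodesics"
    by (simp add: openin_geodesic_topology)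
  then show "geodesics \<subseteq> topspace geodesic_topology"
    by (rule openin_subset)
qed

lemma quotient_map_geodesic_topology:
  "quotient_map (top_of_set ordered_geodesics) geodesic_topology (\<lambda>(u, v). Upair u v)"
proof -
  have "(\<lambda>(u, v). Upair u v) ` ordered_geodesics = geodesics"
    by (force simp: ordered_geodesics_def geodesics_def)
  moreover have "{x \<in> ordered_geodesics. (case x of (u, v) \<Rightarrow> Upair u v) \<in> U} =
      {(u, v) \<in> ordered_geodesics. Upair u v \<in> U}" for U
    by auto
  ultimately show ?thesis
    by (simp add: quotient_map_def topspace_geodesic_topology openin_geodesic_topology)
qed

locale geodesic_current =
  fixes \<Gamma> :: "(complex \<Rightarrow> complex) set" and \<mu> :: "complex uprod measure"
  assumes borel: "sets \<mu> = sets (sigma geodesics {U. openin geodesic_topology U})"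
    and invariant: "g \<in> \<Gamma> \<Longrightarrow> A \<in> sets \<mu> \<Longrightarrow> emeasure \<mu> (map_uprod g ` A) = emeasure \<mu> A"
    and locally_finite: "\<gamma> \<in> geodesics \<Longrightarrow>
      \<exists>U. openin geodesic_topology U \<and> \<gamma> \<in> U \<and> emeasure \<mu> U < \<infinity>"
    and inner_regular: "A \<in> sets \<mu> \<Longrightarrow>
      emeasure \<mu> A = (SUP K\<in>{K. compactin geodesic_topology K \<and> K \<subseteq> A}. emeasure \<mu> K)"

section \<open>The dual space\<close>

definition geodesic_line :: "complex uprod \<Rightarrow> complex set" where
  "geodesic_line \<gamma> = convex hull (set_uprod \<gamma>) \<inter> hyp_plane"

definition transverse_geodesics :: "complex set \<Rightarrow> complex uprod set" where
  "transverse_geodesics \<tau> = {\<gamma> \<in> geodesics. \<exists>p. geodesic_line \<gamma> \<inter> \<tau> = {p}}"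

definition current_dist :: "complex uprod measure \<Rightarrow> complex \<Rightarrow> complex \<Rightarrow> real" where
  "current_dist \<mu> x y =
     (measure \<mu> (transverse_geodesics (hyp_segment x y - {y})) +
      measure \<mu> (transverse_geodesics (hyp_segment x y - {x}))) / 2"

definition dual_rel :: "complex uprod measure \<Rightarrow> (complex \<times> complex) set" where
  "dual_rel \<mu> = {(x, y). x \<in> hyp_plane \<and> y \<in> hyp_plane \<and> current_dist \<mu> x y = 0}"

definition dual_space :: "complex uprod measure \<Rightarrow> complex set set" where
  "dual_space \<mu> = hyp_plane // dual_rel \<mu>"

text \<open>
  The choice of representatives is immaterial on \<^term>\<open>dual_space \<mu>\<close>; \<^locale>\<open>Metric_space\<close> asks for
  non-negativity and symmetry also off the carrier, which this form of the definition provides.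
\<close>

definition dual_dist :: "complex uprod measure \<Rightarrow> complex set \<Rightarrow> complex set \<Rightarrow> real" where
  "dual_dist \<mu> P Q = current_dist \<mu> (SOME x. x \<in> P) (SOME y. y \<in> Q)"

section \<open>Boxes\<close>

text \<open>
  \<open>circle_intervals s t\<close> is the set of all \<open>I\<^bsub>a,b\<^esub>\<close> with endpoints \<open>a = cis s\<close> and \<open>b = cis t\<close>,
  for angles \<open>s \<le> t \<le> s + 2 * pi\<close>.
\<close>

definition circle_intervals :: "real \<Rightarrow> real \<Rightarrow> complex set set" where
  "circle_intervals s t =
     {cis ` {s..t}, cis ` {s..<t}, cis ` {s<..t}, cis ` {s<..<t}} - {{}}"

definition box :: "complex set \<Rightarrow> complex set \<Rightarrow> complex uprod set" where
  "box I J = {Upair u v |u v. u \<in> I \<and> v \<in> J}"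

text \<open>The pairs consisting of a box \<open>B\<close> and its opposite box.\<close>

definition opposite_boxes :: "(complex uprod set \<times> complex uprod set) set" where
  "opposite_boxes = {(box Iab Icd, box Ida Ibc) |Iab Ibc Icd Ida.
     \<exists>a b c d. a \<le> b \<and> b \<le> c \<and> c \<le> d \<and> d \<le> a + 2 * pi \<and>
       Iab \<in> circle_intervals a b \<and> Ibc \<in> circle_intervals b c \<and>
       Icd \<in> circle_intervals c d \<and> Ida \<in> circle_intervals d (a + 2 * pi) \<and>
       Iab \<union> Ibc \<union> Icd \<union> Ida = hyp_boundary \<and>
       Iab \<inter> Ibc = {} \<and> Iab \<inter> Icd = {} \<and> Iab \<inter> Ida = {} \<and>
       Ibc \<inter> Icd = {} \<and> Ibc \<inter> Ida = {} \<and> Icd \<inter> Ida = {}}"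

definition box_constant :: "complex uprod measure \<Rightarrow> ennreal" where
  "box_constant \<mu> = (SUP (B, B')\<in>opposite_boxes. min (emeasure \<mu> B) (emeasure \<mu> B'))"

section \<open>Hyperbolicity\<close>

definition hyperbolic_space :: "real \<Rightarrow> 'a set \<Rightarrow> ('a \<Rightarrow> 'a \<Rightarrow> real) \<Rightarrow> bool" where
  "hyperbolic_space \<delta> Y d \<longleftrightarrow> Metric_space Y d \<and>
     (\<forall>x\<in>Y. \<forall>y\<in>Y. \<forall>z\<in>Y. \<forall>w\<in>Y.
        let S = sort [d x y + d z w, d x z + d y w, d y z + d x w]
        in S ! 2 - S ! 1 \<le> 2 * \<delta>)"

end

theory Submission
  imports Defs
begin

text \<open>
  Let \<open>s\<^sub>\<gamma>(p) \<in> {-1, 0, 1}\<close> record the side of the geodesic \<open>\<gamma>\<close> on which \<open>p\<close> lies. Then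
  \<open>d\<^sub>\<mu>(x, y) = 1/2 \<integral> \<bar>s\<^sub>\<gamma>(x) - s\<^sub>\<gamma>(y)\<bar> d\<mu>(\<gamma>)\<close>, and four numbers on the real line satisfy the four-point
  equality of a tree. Hence, up to relabelling, the defect of the four-point condition is at most
  \<open>2 min {\<mu>(V), \<mu>(V')}\<close>, where \<open>V\<close> and \<open>V'\<close> consist of the geodesics that (weakly) separate \<open>x, y\<close>
  from \<open>z, w\<close> and \<open>x, w\<close> from \<open>y, z\<close>. A geodesic of \<open>V\<close> or \<open>V'\<close> strictly separates \<open>x\<close> from \<open>z\<close> or passes
  through exactly one of them, so it separates the ends at infinity of the line \<open>xz\<close>, and likewise for \<open>yw\<close>;
  these four ends are the corners of a pair of opposite boxes containing \<open>V\<close> and \<open>V'\<close>.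

  Conversely, a box and its opposite are exhausted by boxes over compact arcs. Four points of the circle
  lying in the gaps between the arcs, moved slightly into the disc, are in convex position and realise
  the defect \<open>2 min {\<mu>(B), \<mu>(B\<^sup>\<bottom>)}\<close> up to any error.

  The supremum is finite because a deck transformation moves the crossing point of the two diagonals
  of a box into a fixed compact set; then one of the two opposite boxes
  contains only geodesics whose ends are a definite Euclidean distance apart.
\<close>

section \<open>Sides of chords\<close>

text \<open>The planar cross product of \<open>v - u\<close> and \<open>p - u\<close>: positive to
  the left of the chord directed from \<open>u\<close> to \<open>v\<close>, and affine in
  \<open>p\<close>.\<close>

definition side :: "complex \<Rightarrow> complex \<Rightarrow> complex \<Rightarrow> real" where
  "side u v p = Im (cnj (v - u) * (p - u))"

lemma ccw_iff_side: "ccw u v p \<longleftrightarrow> 0 < side u v p"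
  by (simp add: ccw_def side_def)

lemma side_swap: "side v u p = - side u v p"
  by (simp add: side_def algebra_simps)

lemma side_endpoints [simp]: "side u v u = 0" "side u v v = 0" "side u u p = 0"
  by (simp_all add: side_def algebra_simps)

lemma side_affine: "side u v ((1 - t) *\<^sub>R x + t *\<^sub>R y) = (1 - t) * side u v x + t * side u v y"
  by (simp add: side_def algebra_simps)

lemma side_ray: "side u v (x + t *\<^sub>R (x - z)) = (1 + t) * side u v x - t * side u v z"
  by (simp add: side_def algebra_simps)

section \<open>Sides in angular coordinates\<close>

text \<open>For unit vectors the cross product is a signed sum of the sines of the three angle
  differences. Such a sum factors, and the factors expose its sign.\<close>

lemma side_cis:
  "side (cis \<alpha>) (cis \<beta>) (cis \<theta>) =
     4 * sin ((\<beta> - \<alpha>) / 2) * sin ((\<theta> - \<beta>) / 2) * sin ((\<theta> - \<alpha>) / 2)"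
proof -
  define p q r where "p = (\<beta> - \<alpha>) / 2" and "q = (\<theta> - \<beta>) / 2" and "r = \<alpha>"
  have e: "\<alpha> = r" "\<beta> = r + 2 * p" "\<theta> = r + 2 * (p + q)"
    by (auto simp: p_def q_def r_def field_simps)
  have "side (cis \<alpha>) (cis \<beta>) (cis \<theta>) = sin (\<beta> - \<alpha>) + sin (\<theta> - \<beta>) - sin (\<theta> - \<alpha>)"
    unfolding side_def sin_diff using sin_cos_squared_add[of \<alpha>] by (simp add: algebra_simps)
  also have "\<dots> = sin (2 * p) + sin (2 * q) - sin (2 * (p + q))"
    unfolding e by (simp add: algebra_simps)
  also have "\<dots> = 4 * sin p * sin q * sin (p + q)"
    unfolding sin_double sin_add cos_add
    using sin_cos_squared_add[of p] sin_cos_squared_add[of q] by algebra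
  also have "p + q = (\<theta> - \<alpha>) / 2" by (simp add: p_def q_def field_simps)
  finally show ?thesis by (simp only: p_def q_def)
qed

text \<open>Cutting the circle at \<open>A\<close> keeps all halved angle differences strictly
  between \<open>- pi\<close> and \<open>pi\<close>, where the sine has the sign of its argument.
  The order of the angles then decides the side.\<close>

lemma side_cis_sgn:
  assumes "A \<le> \<alpha>" "\<alpha> < \<beta>" "\<beta> < A + 2 * pi" "A \<le> \<theta>" "\<theta> < A + 2 * pi"
  shows "side (cis \<alpha>) (cis \<beta>) (cis \<theta>) < 0 \<longleftrightarrow> \<alpha> < \<theta> \<and> \<theta> < \<beta>"
    and "0 < side (cis \<alpha>) (cis \<beta>) (cis \<theta>) \<longleftrightarrow> \<theta> < \<alpha> \<or> \<beta> < \<theta>"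
proof -
  have s: "sgn (sin (t / 2)) = sgn t" if "\<bar>t\<bar> < 2 * pi" for t :: real
  proof (cases t "0::real" rule: linorder_cases)
    case less
    then have "sin (- t / 2) > 0" using that by (intro sin_gt_zero) auto
    then show ?thesis using less by simp
  next
    case greater
    then have "sin (t / 2) > 0" using that by (intro sin_gt_zero) auto
    then show ?thesis using greater by simp
  qed simp
  have "sgn (side (cis \<alpha>) (cis \<beta>) (cis \<theta>)) = sgn (\<beta> - \<alpha>) * sgn (\<theta> - \<beta>) * sgn (\<theta> - \<alpha>)"
    unfolding side_cis sgn_mult using assms by (simp add: s)
  then have *: "sgn (side (cis \<alpha>) (cis \<beta>) (cis \<theta>)) = sgn ((\<theta> - \<beta>) * (\<theta> - \<alpha>))"
    using assms by (simp add: sgn_mult)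
  have "side (cis \<alpha>) (cis \<beta>) (cis \<theta>) < 0 \<longleftrightarrow> (\<theta> - \<beta>) * (\<theta> - \<alpha>) < 0"
    "0 < side (cis \<alpha>) (cis \<beta>) (cis \<theta>) \<longleftrightarrow> 0 < (\<theta> - \<beta>) * (\<theta> - \<alpha>)"
    using * by (metis sgn_less sgn_greater)+
  then show "side (cis \<alpha>) (cis \<beta>) (cis \<theta>) < 0 \<longleftrightarrow> \<alpha> < \<theta> \<and> \<theta> < \<beta>"
    "0 < side (cis \<alpha>) (cis \<beta>) (cis \<theta>) \<longleftrightarrow> \<theta> < \<alpha> \<or> \<beta> < \<theta>"
    using assms by (auto simp: mult_less_0_iff zero_less_mult_iff)
qed

lemma sphere_cis:
  assumes "u \<in> sphere 0 1"
  obtains \<theta> where "A \<le> \<theta>" "\<theta> < A + 2 * pi" "u = cis \<theta>"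
proof -
  have "norm (u * cis (-A)) = 1" using assms by (simp add: norm_mult)
  then have "u * cis (-A) = cis (Arg2pi (u * cis (-A)))"
    using Arg2pi_eq[of "u * cis (-A)"] by (simp add: cis_conv_exp)
  then have "u = cis (Arg2pi (u * cis (-A)) + A)"
    by (metis add_minus_cancel add.commute cis_mult mult.assoc mult.commute mult.right_neutral
        cis_zero add.right_inverse)
  then show ?thesis using that Arg2pi_ge_0[of "u * cis (-A)"] Arg2pi_lt_2pi[of "u * cis (-A)"]
    by (metis add.commute add_increasing2 add_less_cancel_left le_add_same_cancel1 order_refl)
qed

lemma cis_inj:
  assumes "cis \<alpha> = cis \<beta>" "\<bar>\<alpha> - \<beta>\<bar> < 2 * pi" shows "\<alpha> = \<beta>"
proof -
  have "sin \<alpha> = sin \<beta> \<and> cos \<alpha> = cos \<beta>" using assms(1) by (simp add: complex_eq_iff)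
  then obtain n :: int where n: "\<alpha> = \<beta> + 2 * pi * n" by (subst (asm) sin_cos_eq_iff) auto
  then have "\<bar>2 * pi * real_of_int n\<bar> < 2 * pi" using assms(2) by simp
  then have "\<bar>real_of_int n\<bar> < 1" by (simp add: abs_mult)
  then have "n = 0" by linarith
  then show ?thesis using n by simp
qed

lemma side_eq_0_iff_segment:
  assumes "u \<in> sphere 0 1" "v \<in> sphere 0 1" "u \<noteq> v" "p \<in> ball 0 1"
  shows "side u v p = 0 \<longleftrightarrow> p \<in> closed_segment u v"
proof
  assume "p \<in> closed_segment u v"
  then obtain t where "p = (1 - t) *\<^sub>R u + t *\<^sub>R v" by (auto simp: in_segment)
  then show "side u v p = 0" by (simp only: side_affine side_endpoints)
next
  assume s: "side u v p = 0"
  \<comment> \<open>The parameter of the orthogonal projection of \<open>p\<close> onto the line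
    through \<open>u\<close> and \<open>v\<close>.\<close>
  define t where "t = ((p - u) \<bullet> (v - u)) / (norm (v - u))\<^sup>2"
  have n: "(norm (v - u))\<^sup>2 > 0" using assms by simp
  obtain u1 u2 v1 v2 p1 p2 where c: "u = Complex u1 u2" "v = Complex v1 v2" "p = Complex p1 p2"
    by (metis complex.exhaust)
  have nn: "(norm (v - u))\<^sup>2 = (v1 - u1)^2 + (v2 - u2)^2" by (simp add: c cmod_power2)
  have t: "t * ((v1 - u1)^2 + (v2 - u2)^2) = (p1 - u1) * (v1 - u1) + (p2 - u2) * (v2 - u2)"
    using n unfolding t_def nn[symmetric] by (simp add: c inner_complex_def)
  have s': "(v1 - u1) * (p2 - u2) = (v2 - u2) * (p1 - u1)" using s by (simp add: c side_def algebra_simps)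
  have "((v1 - u1)^2 + (v2 - u2)^2) * (p1 - u1 - t * (v1 - u1)) = 0"
    "((v1 - u1)^2 + (v2 - u2)^2) * (p2 - u2 - t * (v2 - u2)) = 0" using t s' by algebra+
  then have "p1 = u1 + t * (v1 - u1)" "p2 = u2 + t * (v2 - u2)" using n nn by auto
  then have p: "p = (1 - t) *\<^sub>R u + t *\<^sub>R v" by (simp add: c complex_eq_iff algebra_simps)
  have uv: "u1^2 + u2^2 = 1" "v1^2 + v2^2 = 1" using assms
    by (auto simp: c norm_complex_def)
  have pp: "p1^2 + p2^2 < 1" using assms(4) by (simp add: c norm_complex_def)
  \<comment> \<open>Along a line through two points of the unit circle, one minus the squared norm
    is \<open>t * (1 - t)\<close> times the squared chord length; so lying in the disc confines
    \<open>t\<close> to the segment.\<close>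
  have "1 - (p1^2 + p2^2) = t * (1 - t) * ((v1 - u1)^2 + (v2 - u2)^2)"
    using \<open>p1 = _\<close> \<open>p2 = _\<close> uv by algebra
  then have "t * (1 - t) * ((v1 - u1)^2 + (v2 - u2)^2) > 0" using pp by simp
  then have "t * (1 - t) > 0" using n nn by (simp add: zero_less_mult_iff)
  then have "0 \<le> t" "t \<le> 1" by (auto simp: zero_less_mult_iff)
  then show "p \<in> closed_segment u v" unfolding in_segment using p by blast
qed

section \<open>Lengths of chords\<close>

lemma chord_length_ge:
  fixes u v p :: complex
  assumes "u \<in> sphere 0 1" "v \<in> sphere 0 1" "p \<in> closed_segment u v" "norm p \<le> r"
  shows "2 * (1 - r) \<le> dist u v"
proof -
  have "dist u v = dist u p + dist p v" using assms(3) between[of u v p] between_mem_segment[of u v p] by simp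
  moreover have "dist u p \<ge> 1 - r" "dist p v \<ge> 1 - r" using assms
    norm_triangle_ineq2[of u p] norm_triangle_ineq2[of v p] by (auto simp: dist_norm norm_minus_commute)
  ultimately show ?thesis by simp
qed

text \<open>The cap on the positive side does not contain the centre in its interior, so its arc is
  at most a half circle, and no two points of such an arc are further apart than its ends.\<close>

lemma small_cap:
  assumes "u \<in> sphere 0 1" "v \<in> sphere 0 1" "p \<in> sphere 0 1" "q \<in> sphere 0 1" "u \<noteq> v"
    "0 \<le> side u v p" "0 \<le> side u v q" "side u v 0 \<le> 0"
  shows "dist p q \<le> dist u v"
proof -
  obtain \<alpha> where \<alpha>: "u = cis \<alpha>" using assms(1) by (rule sphere_cis[where A = 0])
  obtain \<beta> where \<beta>: "\<alpha> \<le> \<beta>" "\<beta> < \<alpha> + 2 * pi" "v = cis \<beta>" using assms(2) by (rule sphere_cis)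
  have "\<alpha> \<noteq> \<beta>" using \<alpha> \<beta> assms by auto
  \<comment> \<open>Half-length and mid-angle of the arc from \<open>u\<close> to \<open>v\<close>.
    The opposite cap consists of the angles \<open>R\<close> with
    \<open>cos (R - \<theta>) \<le> cos \<phi>\<close>.\<close>
  define \<phi> \<theta> where "\<phi> = (\<beta> - \<alpha>) / 2" and "\<theta> = (\<beta> + \<alpha>) / 2"
  have uv: "u = cis (\<theta> - \<phi>)" "v = cis (\<theta> + \<phi>)"
    unfolding \<alpha> \<beta> \<phi>_def \<theta>_def by (simp_all add: field_simps)
  have \<phi>: "sin \<phi> > 0" using \<beta> \<open>\<alpha> \<noteq> \<beta>\<close> by (intro sin_gt_zero) (auto simp: \<phi>_def)
  obtain P where P: "p = cis P" using assms(3) by (rule sphere_cis[where A = 0])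
  obtain Q where Q: "q = cis Q" using assms(4) by (rule sphere_cis[where A = 0])
  have side: "side u v (cis R) = 2 * sin \<phi> * (cos \<phi> - cos (R - \<theta>))" for R
  proof -
    have "side u v (cis R) = 4 * sin \<phi> * (sin ((R - \<theta> - \<phi>) / 2) * sin ((R - \<theta> + \<phi>) / 2))"
      unfolding uv side_cis by (simp add: algebra_simps)
    moreover have "(R - \<theta> - \<phi>) / 2 - (R - \<theta> + \<phi>) / 2 = - \<phi>" "(R - \<theta> - \<phi>) / 2 + (R - \<theta> + \<phi>) / 2 = R - \<theta>"
      by (simp_all add: field_simps)
    ultimately show ?thesis unfolding sin_times_sin by simp
  qed
  have "side u v 0 = sin (2 * \<phi>)"
    unfolding uv side_def sin_double cis.simps complex.sel
    by (simp add: cos_add sin_add cos_diff sin_diff) (use sin_cos_squared_add[of \<theta>] in algebra)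
  \<comment> \<open>The centre lies on the side of this arc, so the arc is at least a half
    circle.\<close>
  then have c: "cos \<phi> \<le> 0" using assms(8) \<phi> by (simp add: sin_double mult_le_0_iff)
  have cP: "cos (P - \<theta>) \<le> cos \<phi>" "cos (Q - \<theta>) \<le> cos \<phi>"
    using assms(6,7) \<phi> unfolding P Q side by (simp_all add: zero_le_mult_iff)
  have s: "\<bar>sin (R - \<theta>)\<bar> \<le> sin \<phi>" if "cos (R - \<theta>) \<le> cos \<phi>" for R
  proof -
    have "(cos \<phi>)\<^sup>2 \<le> (cos (R - \<theta>))\<^sup>2" using that c by (simp add: abs_le_square_iff[symmetric])
    then have "(sin (R - \<theta>))\<^sup>2 \<le> (sin \<phi>)\<^sup>2" by (simp add: sin_squared_eq)
    then show ?thesis using \<phi> by (simp add: abs_le_square_iff[symmetric])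
  qed
  have "\<bar>sin (P - \<theta>)\<bar> * \<bar>sin (Q - \<theta>)\<bar> \<le> sin \<phi> * sin \<phi>"
    using s cP \<phi> by (intro mult_mono) auto
  then have "- (sin (P - \<theta>) * sin (Q - \<theta>)) \<le> sin \<phi> * sin \<phi>"
    using abs_ge_minus_self[of "sin (P - \<theta>) * sin (Q - \<theta>)"] by (simp add: abs_mult)
  moreover have "cos \<phi> * cos \<phi> \<le> cos (P - \<theta>) * cos (Q - \<theta>)"
    using cP c mult_mono[of "- cos \<phi>" "- cos (P - \<theta>)" "- cos \<phi>" "- cos (Q - \<theta>)"] by simp
  ultimately have "cos (2 * \<phi>) \<le> cos ((P - \<theta>) - (Q - \<theta>))"
    unfolding cos_diff[of "P - \<theta>"] cos_double by (simp add: power2_eq_square)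
  then have le: "cos (2 * \<phi>) \<le> cos (P - Q)" by simp
  \<comment> \<open>Squared chord lengths decrease with the cosine of the angle difference, so
    comparing cosines is enough.\<close>
  have d: "(dist (cis R) (cis S))\<^sup>2 = 2 - 2 * cos (R - S)" for R S
    unfolding dist_norm cmod_power2 cos_diff by (simp add: power2_diff sin_squared_eq)
  have "(dist p q)\<^sup>2 \<le> (dist u v)\<^sup>2" unfolding P Q uv d using le cos_minus[of "2 * \<phi>"] by simp
  then show ?thesis by (simp add: abs_le_square_iff[symmetric])
qed

text \<open>One of the two sides of the chord is a cap of at most a half circle. Reversing the chord
  covers the case where it is the negative side.\<close>

lemma separating_chord_length:
  assumes "u \<in> sphere 0 1" "v \<in> sphere 0 1"
    "a \<in> sphere 0 1" "b \<in> sphere 0 1" "c \<in> sphere 0 1" "d \<in> sphere 0 1"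
    "side u v a < 0" "side u v b < 0" "side u v c > 0" "side u v d > 0"
  shows "dist a b \<le> dist u v \<or> dist c d \<le> dist u v"
proof -
  have ne: "u \<noteq> v" using assms(7) by (auto simp: side_def)
  show ?thesis
  proof (cases "side u v 0 \<le> 0")
    case True
    then have "dist c d \<le> dist u v" using assms ne by (intro small_cap) auto
    then show ?thesis ..
  next
    case False
    then have "dist a b \<le> dist v u" using assms ne side_swap[of u v] by (intro small_cap) auto
    then show ?thesis by (simp add: dist_commute)
  qed
qed

section \<open>Boxes and separated endpoints\<close>

lemma ray_meets_circle:
  fixes x z :: complex
  assumes "norm x < 1" "x \<noteq> z"
  obtains t where "t > 0" "norm (x + t *\<^sub>R (x - z)) = 1"
proof -
  \<comment> \<open>A displacement of length 2 from a point of the disc ends outside the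
    disc.\<close>
  define T where "T = 2 / norm (x - z)"
  have T: "T > 0" "norm (T *\<^sub>R (x - z)) = 2" using assms by (auto simp: T_def)
  have "1 \<le> norm (x + T *\<^sub>R (x - z))"
    using norm_diff_ineq[of "T *\<^sub>R (x - z)" x] T assms(1) by (simp add: add.commute)
  moreover have "norm (x + 0 *\<^sub>R (x - z)) \<le> 1" using assms by simp
  moreover have "continuous_on {0..T} (\<lambda>t. norm (x + t *\<^sub>R (x - z)))" by (intro continuous_intros)
  ultimately obtain t where t: "0 \<le> t" "t \<le> T" "norm (x + t *\<^sub>R (x - z)) = 1"
    using IVT'[of "\<lambda>t. norm (x + t *\<^sub>R (x - z))" 0 1 T] T by auto
  have "t \<noteq> 0" using t(3) assms(1) by auto
  then show ?thesis using that[of t] t by simp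
qed

section \<open>Boxes containing the pairs that separate four boundary points\<close>

lemma box_commute: "box I J = box J I"
  unfolding box_def by (metis Upair_inject)

lemma box_mono: "I \<subseteq> I' \<Longrightarrow> J \<subseteq> J' \<Longrightarrow> box I J \<subseteq> box I' J'"
  by (auto simp: box_def)

text \<open>Putting \<open>a\<close> and \<open>b\<close> on the negative side only fixes an
  orientation of the unordered pair. The strict signs force \<open>u \<noteq> v\<close>.\<close>

definition separating_pairs :: "complex \<Rightarrow> complex \<Rightarrow> complex \<Rightarrow> complex \<Rightarrow> complex uprod set" where
  "separating_pairs a b c d = {Upair u v |u v. u \<in> sphere 0 1 \<and> v \<in> sphere 0 1 \<and>
     side u v a < 0 \<and> side u v b < 0 \<and> side u v c > 0 \<and> side u v d > 0}"

lemma separating_pairs_commute: "separating_pairs a b c d = separating_pairs a b d c"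
  unfolding separating_pairs_def by blast

text \<open>With the cut of the circle placed at the first point, that point cannot lie strictly
  between the two end angles. Hence the arc between them is the side of \<open>c\<close> and
  \<open>d\<close>.\<close>

lemma separating_pairs_angles:
  assumes "\<gamma> \<in> separating_pairs (cis A) (cis b) (cis c) (cis d)"
    and "A \<le> b" "b < A + 2 * pi" "A \<le> c" "c < A + 2 * pi" "A \<le> d" "d < A + 2 * pi"
  obtains \<alpha> \<beta> where "\<gamma> = Upair (cis \<alpha>) (cis \<beta>)" "A < \<alpha>" "\<alpha> < \<beta>" "\<beta> < A + 2 * pi"
    "b < \<alpha> \<or> \<beta> < b" "\<alpha> < c" "c < \<beta>" "\<alpha> < d" "d < \<beta>"
proof -
  from assms(1) obtain u v where \<gamma>: "\<gamma> = Upair u v" "u \<in> sphere 0 1" "v \<in> sphere 0 1"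
    and s: "side u v (cis A) < 0" "side u v (cis b) < 0" "side u v (cis c) > 0" "side u v (cis d) > 0"
    unfolding separating_pairs_def by blast
  obtain \<beta> where \<beta>: "A \<le> \<beta>" "\<beta> < A + 2 * pi" "u = cis \<beta>" using \<gamma>(2) by (rule sphere_cis)
  obtain \<alpha> where \<alpha>: "A \<le> \<alpha>" "\<alpha> < A + 2 * pi" "v = cis \<alpha>" using \<gamma>(3) by (rule sphere_cis)
  \<comment> \<open>Otherwise the smallest angle \<open>A\<close> would lie strictly between the
    ends.\<close>
  have "\<not> \<beta> < \<alpha>" using s(1) \<alpha> \<beta> side_cis_sgn(1)[of A \<beta> \<alpha> A] by auto
  moreover have "\<alpha> \<noteq> \<beta>" using s(1) \<alpha> \<beta> by (auto simp: side_def)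
  ultimately have lt: "\<alpha> < \<beta>" by simp
  note sg = side_cis_sgn[OF \<alpha>(1) lt \<beta>(2)]
  have "A < \<alpha> \<or> \<beta> < A" "b < \<alpha> \<or> \<beta> < b" "\<alpha> < c \<and> c < \<beta>" "\<alpha> < d \<and> d < \<beta>"
    using sg(2)[of A] sg(2)[of b] sg(1)[of c] sg(1)[of d] s side_swap[of u v] assms(2-)
    by (auto simp: \<alpha>(3) \<beta>(3))
  then show ?thesis using that[of \<alpha> \<beta>] \<gamma>(1) \<alpha> \<beta> lt by (auto simp: Upair_inject)
qed

text \<open>Alternating open and closed arcs gives every corner to exactly one arc, so the four arcs
  partition the circle.\<close>

lemma opposite_boxes_cis:
  assumes "a < b" "b < c" "c < d" "d < a + 2 * pi"
  shows "(box (cis ` {a<..<b}) (cis ` {c<..<d}), box (cis ` {d..a + 2 * pi}) (cis ` {b..c})) \<in> opposite_boxes"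
proof -
  have inj: "cis \<theta> \<noteq> cis \<theta>'" if "\<theta> \<in> S" "\<theta>' \<in> S'" "S \<subseteq> {a<..a + 2 * pi}" "S' \<subseteq> {a<..a + 2 * pi}" "S \<inter> S' = {}"
    for \<theta> \<theta>' S S'
  proof
    assume "cis \<theta> = cis \<theta>'"
    moreover have "\<bar>\<theta> - \<theta>'\<bar> < 2 * pi" using that by (force simp: subset_iff abs_less_iff)
    ultimately show False using cis_inj that by blast
  qed
  have disj: "cis ` S \<inter> cis ` S' = {}" if "S \<subseteq> {a<..a + 2 * pi}" "S' \<subseteq> {a<..a + 2 * pi}" "S \<inter> S' = {}" for S S'
    using inj[OF _ _ that] by blast
  have un: "cis ` {a<..<b} \<union> cis ` {b..c} \<union> cis ` {c<..<d} \<union> cis ` {d..a + 2 * pi} = hyp_boundary"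
  proof (intro equalityI subsetI)
    fix u assume "u \<in> hyp_boundary"
    then obtain \<theta> where \<theta>: "a \<le> \<theta>" "\<theta> < a + 2 * pi" "u = cis \<theta>" by (rule sphere_cis)
    show "u \<in> cis ` {a<..<b} \<union> cis ` {b..c} \<union> cis ` {c<..<d} \<union> cis ` {d..a + 2 * pi}"
    proof (cases "\<theta> = a")
      case True
      \<comment> \<open>The half-open range of angles omits \<open>a\<close>; this point is
        represented by the far end of the last, closed arc.\<close>
      have "cis (a + 2 * pi) = u" using \<theta> True by (simp add: complex_eq_iff)
      then show ?thesis using assms by force
    next
      case False
      then have "\<theta> \<in> {a<..<b} \<union> {b..c} \<union> {c<..<d} \<union> {d..a + 2 * pi}" using \<theta> by auto
      then show ?thesis using \<theta> by blast
    qed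
  qed auto
  have ne: "{a<..<b} \<noteq> {}" "{c<..<d} \<noteq> {}" "{d..a + 2 * pi} \<noteq> {}" "{b..c} \<noteq> {}" using assms by auto
  have "cis ` {a<..<b} \<inter> cis ` {b..c} = {}" "cis ` {a<..<b} \<inter> cis ` {c<..<d} = {}"
    "cis ` {a<..<b} \<inter> cis ` {d..a + 2 * pi} = {}" "cis ` {b..c} \<inter> cis ` {c<..<d} = {}"
    "cis ` {b..c} \<inter> cis ` {d..a + 2 * pi} = {}" "cis ` {c<..<d} \<inter> cis ` {d..a + 2 * pi} = {}"
    using assms by (intro disj; auto)+
  moreover have "cis ` {a<..<b} \<in> circle_intervals a b" "cis ` {b..c} \<in> circle_intervals b c"
    "cis ` {c<..<d} \<in> circle_intervals c d" "cis ` {d..a + 2 * pi} \<in> circle_intervals d (a + 2 * pi)"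
    using ne by (auto simp: circle_intervals_def)
  moreover have "a \<le> b \<and> b \<le> c \<and> c \<le> d \<and> d \<le> a + 2 * pi" using assms by simp
  ultimately show ?thesis unfolding opposite_boxes_def mem_Collect_eq using un by blast
qed

text \<open>The existence of both kinds of pairs forces \<open>a\<close>, \<open>b\<close>,
  \<open>c\<close>, \<open>d\<close> to occur in this cyclic order, in one direction or the other. A
  pair that separates two neighbours from the other two has its ends in two opposite arcs.\<close>

lemma separating_pairs_opposite_boxes:
  assumes "a \<in> sphere 0 1" "b \<in> sphere 0 1" "c \<in> sphere 0 1" "d \<in> sphere 0 1"
    and "separating_pairs a b c d \<noteq> {}" "separating_pairs a d b c \<noteq> {}"
  obtains B B' where "(B, B') \<in> opposite_boxes"
    "separating_pairs a b c d \<subseteq> B \<and> separating_pairs a d b c \<subseteq> B' \<or>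
     separating_pairs a b c d \<subseteq> B' \<and> separating_pairs a d b c \<subseteq> B"
proof -
  obtain A where a: "a = cis A" using assms(1) by (rule sphere_cis[where A = 0])
  obtain \<beta> where b: "A \<le> \<beta>" "\<beta> < A + 2 * pi" "b = cis \<beta>" using assms(2) by (rule sphere_cis)
  obtain \<gamma> where c: "A \<le> \<gamma>" "\<gamma> < A + 2 * pi" "c = cis \<gamma>" using assms(3) by (rule sphere_cis)
  obtain \<delta> where d: "A \<le> \<delta>" "\<delta> < A + 2 * pi" "d = cis \<delta>" using assms(4) by (rule sphere_cis)
  note abcd = a b(3) c(3) d(3)
  \<comment> \<open>A pair with \<open>A\<close>, \<open>p\<close> on one side and \<open>q\<close>,
    \<open>r\<close> on the other has one end between \<open>p\<close> and \<open>q\<close> and one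
    between \<open>r\<close> and \<open>A\<close>; the other pairing uses the remaining two
    arcs.\<close>
  have boxes: "separating_pairs (cis A) (cis p) (cis q) (cis r) \<subseteq> box (cis ` {r..A + 2 * pi}) (cis ` {p..q})"
    "separating_pairs (cis A) (cis r) (cis p) (cis q) \<subseteq> box (cis ` {A<..<p}) (cis ` {q<..<r})"
    if o: "A < p" "p < q" "q < r" "r < A + 2 * pi" for p q r
  proof -
    show "separating_pairs (cis A) (cis p) (cis q) (cis r) \<subseteq> box (cis ` {r..A + 2 * pi}) (cis ` {p..q})"
    proof
      fix g assume "g \<in> separating_pairs (cis A) (cis p) (cis q) (cis r)"
      then obtain s t where "g = Upair (cis s) (cis t)" "A < s" "s < t" "t < A + 2 * pi"
        "p < s \<or> t < p" "s < q" "q < t" "s < r" "r < t"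
        using o by (elim separating_pairs_angles) auto
      then have "g = Upair (cis t) (cis s)" "t \<in> {r..A + 2 * pi}" "s \<in> {p..q}" using o by auto
      then show "g \<in> box (cis ` {r..A + 2 * pi}) (cis ` {p..q})" unfolding box_def by blast
    qed
    show "separating_pairs (cis A) (cis r) (cis p) (cis q) \<subseteq> box (cis ` {A<..<p}) (cis ` {q<..<r})"
    proof
      fix g assume "g \<in> separating_pairs (cis A) (cis r) (cis p) (cis q)"
      then obtain s t where "g = Upair (cis s) (cis t)" "A < s" "s < t" "t < A + 2 * pi"
        "r < s \<or> t < r" "s < p" "p < t" "s < q" "q < t"
        using o by (elim separating_pairs_angles) auto
      then have "g = Upair (cis s) (cis t)" "s \<in> {A<..<p}" "t \<in> {q<..<r}" using o by auto
      then show "g \<in> box (cis ` {A<..<p}) (cis ` {q<..<r})" unfolding box_def by blast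
    qed
  qed
  obtain g where "g \<in> separating_pairs a b c d" using assms(5) by blast
  then obtain s t where 1: "A < s" "s < t" "t < A + 2 * pi"
    "\<beta> < s \<or> t < \<beta>" "s < \<gamma>" "\<gamma> < t" "s < \<delta>" "\<delta> < t"
    unfolding abcd using b c d by (elim separating_pairs_angles) auto
  obtain g' where "g' \<in> separating_pairs a d b c" using assms(6) by blast
  then obtain s' t' where 2: "A < s'" "s' < t'" "t' < A + 2 * pi"
    "\<delta> < s' \<or> t' < \<delta>" "s' < \<beta>" "\<beta> < t'" "s' < \<gamma>" "\<gamma> < t'"
    unfolding abcd using b c d by (elim separating_pairs_angles) auto
  \<comment> \<open>The first witness shows that \<open>\<beta>\<close> is not between
    \<open>\<gamma>\<close> and \<open>\<delta>\<close>, the second that \<open>\<delta>\<close> is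
    not between \<open>\<beta>\<close> and \<open>\<gamma>\<close>.\<close>
  have "A < \<beta> \<and> \<beta> < \<gamma> \<and> \<gamma> < \<delta> \<and> \<delta> < A + 2 * pi \<or> A < \<delta> \<and> \<delta> < \<gamma> \<and> \<gamma> < \<beta> \<and> \<beta> < A + 2 * pi"
    using 1 2 b d by linarith
  then show ?thesis
  proof (elim disjE conjE)
    assume o: "A < \<beta>" "\<beta> < \<gamma>" "\<gamma> < \<delta>" "\<delta> < A + 2 * pi"
    show ?thesis by (rule that[OF opposite_boxes_cis[OF o]]) (simp add: abcd boxes[OF o])
  next
    \<comment> \<open>Reversing the order exchanges \<open>b\<close> and \<open>d\<close>, and with
      them the two boxes; hence the disjunction in the conclusion.\<close>
    assume o: "A < \<delta>" "\<delta> < \<gamma>" "\<gamma> < \<beta>" "\<beta> < A + 2 * pi"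
    show ?thesis
      by (rule that[OF opposite_boxes_cis[OF o]])
        (use boxes[OF o] in \<open>simp add: abcd separating_pairs_commute[of "cis A" "cis \<delta>"] separating_pairs_commute[of "cis A" "cis \<beta>"]\<close>)
  qed
qed

section \<open>Exhaustion of arcs, crossing chords and radial approach to the circle\<close>

lemma circle_interval_exhaustion:
  assumes "I \<in> circle_intervals s t"
  obtains \<alpha> \<beta> :: "nat \<Rightarrow> real" where "decseq \<alpha>" "incseq \<beta>" "\<And>n. s \<le> \<alpha> n" "\<And>n. \<beta> n \<le> t"
    "I = (\<Union>n. cis ` {\<alpha> n..\<beta> n})"
proof -
  \<comment> \<open>The amount trimmed from each open end. Early intervals may be empty, which does
    no harm to the union.\<close>
  define e where "e n = inverse (real (Suc n))" for n
  have e: "decseq e" "\<And>n. 0 < e n" "\<And>x. x > 0 \<Longrightarrow> \<exists>n. e n < x"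
    unfolding e_def using reals_Archimedean by (auto simp: decseq_def intro!: le_imp_inverse_le)
  have lo: "\<exists>n. s + e n \<le> x" if "s < x" for x using e(3)[of "x - s"] that by (auto intro: less_imp_le simp: algebra_simps)
  have hi: "\<exists>n. x \<le> t - e n" if "x < t" for x using e(3)[of "t - x"] that by (auto intro: less_imp_le simp: algebra_simps)
  have eq1: "{s..<t} = (\<Union>n. {s..t - e n})" using hi e(2) by (auto, smt (verit))
  have eq2: "{s<..t} = (\<Union>n. {s + e n..t})" using lo e(2) by (auto, smt (verit))
  have eq3: "{s<..<t} = (\<Union>n. {s + e n..t - e n})"
  proof (intro equalityI subsetI)
    fix x assume "x \<in> {s<..<t}"
    then obtain n m where "s + e n \<le> x" "x \<le> t - e m" using lo hi by (meson greaterThanLessThan_iff)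
    moreover have "e (max n m) \<le> e n" "e (max n m) \<le> e m" using e(1) by (auto simp: decseq_def)
    ultimately have "x \<in> {s + e (max n m)..t - e (max n m)}" by auto
    then show "x \<in> (\<Union>n. {s + e n..t - e n})" by blast
  next
    fix x assume "x \<in> (\<Union>n. {s + e n..t - e n})"
    then obtain n where "s + e n \<le> x" "x \<le> t - e n" by auto
    then show "x \<in> {s<..<t}" using e(2)[of n] by auto
  qed
  have m: "decseq (\<lambda>n. s + e n)" "incseq (\<lambda>n. t - e n)" using e(1) by (auto simp: decseq_def incseq_def)
  have c: "decseq (\<lambda>n. s)" "incseq (\<lambda>n. t)" by auto
  have l: "s \<le> s + e n" "t - e n \<le> t" for n using e(2)[of n] by auto
  consider "I = cis ` {s..t}" | "I = cis ` {s..<t}" | "I = cis ` {s<..t}" | "I = cis ` {s<..<t}"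
    using assms unfolding circle_intervals_def by blast
  then show ?thesis
  proof cases
    case 1 then show ?thesis using that[of "\<lambda>n. s" "\<lambda>n. t"] c by auto
  next
    case 2 then show ?thesis using that[of "\<lambda>n. s" "\<lambda>n. t - e n"] c m l unfolding eq1 image_UN by auto
  next
    case 3 then show ?thesis using that[of "\<lambda>n. s + e n" "\<lambda>n. t"] c m l unfolding eq2 image_UN by auto
  next
    case 4 then show ?thesis using that[of "\<lambda>n. s + e n" "\<lambda>n. t - e n"] c m l unfolding eq3 image_UN by auto
  qed
qed

text \<open>The side with respect to the chord \<open>ac\<close> changes sign along
  \<open>bd\<close>, so \<open>bd\<close> meets the line \<open>ac\<close> at a point interior to
  the disc.\<close>

lemma chords_cross:
  assumes "a < b" "b < c" "c < d" "d < a + 2 * pi"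
  obtains p where "norm p < 1" "p \<in> closed_segment (cis a) (cis c)" "p \<in> closed_segment (cis b) (cis d)"
proof -
  define f where "f = side (cis a) (cis c)"
  have f: "f (cis b) < 0" "f (cis d) > 0" unfolding f_def using assms by (subst side_cis_sgn[where A = a]; auto)+
  \<comment> \<open>The zero of the affine function \<open>f\<close> along the segment from
    \<open>cis b\<close> to \<open>cis d\<close>.\<close>
  define t where "t = f (cis b) / (f (cis b) - f (cis d))"
  have t: "0 < t" "t < 1" using f by (auto simp: t_def field_simps)
  define p where "p = (1 - t) *\<^sub>R cis b + t *\<^sub>R cis d"
  have "f p = 0" unfolding p_def f_def side_affine unfolding t_def using f by (simp add: f_def[symmetric] field_simps)
  have ne: "cis b \<noteq> cis d" using f by auto
  have "norm p < 1"
  proof -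
    have "p \<in> open_segment (cis b) (cis d)" unfolding in_segment p_def using t ne by blast
    then have "dist 0 p < 1"
      using dist_decreases_open_segment[of p "cis b" "cis d" 0] by auto
    then show ?thesis by simp
  qed
  moreover have "cis a \<noteq> cis c" using f by (auto simp: f_def)
  ultimately have "p \<in> closed_segment (cis a) (cis c)" using \<open>f p = 0\<close> side_eq_0_iff_segment unfolding f_def by auto
  moreover have "p \<in> closed_segment (cis b) (cis d)" unfolding in_segment p_def using t by (intro exI[of _ t]) auto
  ultimately show ?thesis using that \<open>norm p < 1\<close> by blast
qed

lemma continuous_on_side [continuous_intros]:
  assumes "continuous_on S f" "continuous_on S g" "continuous_on S h"
  shows "continuous_on S (\<lambda>x. side (f x) (g x) (h x))"
  unfolding side_def using assms by (intro continuous_intros)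

text \<open>Compactness of \<open>C\<close> keeps the nonzero sides uniformly away from zero, so one
  radius close to 1 preserves all signs at once.\<close>

lemma side_radial_sgn:
  assumes "compact C" "C \<subseteq> sphere 0 1 \<times> sphere 0 1" "q \<in> sphere 0 1"
    "\<And>u v. (u, v) \<in> C \<Longrightarrow> side u v q \<noteq> 0"
  shows "eventually (\<lambda>r. \<forall>(u, v)\<in>C. sgn (side u v (r *\<^sub>R q)) = sgn (side u v q)) (at_left 1)"
proof (cases "C = {}")
  case False
  have "continuous_on C (\<lambda>z. \<bar>side (fst z) (snd z) q\<bar>)"
    by (intro continuous_intros)
  from continuous_attains_inf[OF assms(1) False this]
  obtain z where z: "z \<in> C" "\<And>y. y \<in> C \<Longrightarrow> \<bar>side (fst z) (snd z) q\<bar> \<le> \<bar>side (fst y) (snd y) q\<bar>"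
    by blast
  define e where "e = \<bar>side (fst z) (snd z) q\<bar>"
  have e: "e > 0" using z(1) assms(4)[of "fst z" "snd z"] by (simp add: e_def)
  \<comment> \<open>Moving from \<open>q\<close> to \<open>r *\<^sub>R q\<close> changes a side by
    at most \<open>2 * (1 - r)\<close>, which must stay below \<open>e\<close>.\<close>
  have "eventually (\<lambda>r. r \<in> {1 - e / 2<..<1}) (at_left (1::real))"
    using e by (intro eventually_at_left_real) auto
  then show ?thesis
  proof eventually_elim
    case (elim r)
    show ?case
    proof (intro ballI, clarify)
      fix u v assume uv: "(u, v) \<in> C"
      have "side u v (r *\<^sub>R q) - side u v q = (1 - r) * Im (- (cnj (v - u) * q))"
        by (simp add: side_def algebra_simps)
      moreover have "\<bar>Im (- (cnj (v - u) * q))\<bar> \<le> 2"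
      proof -
        have "norm (cnj (v - u) * q) \<le> 2"
          using assms(2,3) uv norm_triangle_ineq4[of v u] by (auto simp: norm_mult simp del: complex_cnj_diff)
        then show ?thesis using abs_Im_le_cmod[of "- (cnj (v - u) * q)"] by (simp only: norm_minus_cancel)
      qed
      then have "\<bar>(1 - r) * Im (- (cnj (v - u) * q))\<bar> \<le> (1 - r) * 2"
        using elim by (simp only: abs_mult) (intro mult_mono; auto)
      ultimately have "\<bar>side u v (r *\<^sub>R q) - side u v q\<bar> < e" using elim by auto
      moreover have "e \<le> \<bar>side u v q\<bar>" using z(2)[OF uv] by (simp add: e_def)
      ultimately show "sgn (side u v (r *\<^sub>R q)) = sgn (side u v q)" by (auto simp: sgn_if split: if_splits)
    qed
  qed
qed simp

section \<open>Currents\<close>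

text \<open>Sets of unordered geodesics are described through ordered pairs; \<open>W\<close> need
  not be symmetric.\<close>

definition geodesics_from :: "(complex \<times> complex) set \<Rightarrow> complex uprod set" where
  "geodesics_from W = {Upair u v |u v. (u, v) \<in> ordered_geodesics \<inter> W}"

lemma Upair_in_geodesics:
  "Upair u v \<in> geodesics \<longleftrightarrow> u \<in> hyp_boundary \<and> v \<in> hyp_boundary \<and> u \<noteq> v"
  unfolding geodesics_def by auto

lemma Upair_in_geodesics_from:
  "Upair u v \<in> geodesics_from W \<longleftrightarrow> Upair u v \<in> geodesics \<and> ((u, v) \<in> W \<or> (v, u) \<in> W)"
proof
  assume "Upair u v \<in> geodesics_from W"
  then obtain u' v' where "Upair u v = Upair u' v'" "(u', v') \<in> ordered_geodesics \<inter> W"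
    unfolding geodesics_from_def by blast
  then show "Upair u v \<in> geodesics \<and> ((u, v) \<in> W \<or> (v, u) \<in> W)"
    by (auto simp: ordered_geodesics_def Upair_in_geodesics)
next
  assume *: "Upair u v \<in> geodesics \<and> ((u, v) \<in> W \<or> (v, u) \<in> W)"
  then have "(u, v) \<in> ordered_geodesics" "(v, u) \<in> ordered_geodesics"
    by (auto simp: ordered_geodesics_def Upair_in_geodesics)
  moreover have "Upair u v = Upair v u" by simp
  ultimately show "Upair u v \<in> geodesics_from W"
    using * unfolding geodesics_from_def by blast
qed

lemma Upair_in_box: "Upair u v \<in> box I J \<longleftrightarrow> u \<in> I \<and> v \<in> J \<or> v \<in> I \<and> u \<in> J"
  unfolding box_def by auto

definition long_chords :: "real \<Rightarrow> complex uprod set" where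
  "long_chords \<epsilon> = {Upair u v |u v. u \<in> hyp_boundary \<and> v \<in> hyp_boundary \<and> \<epsilon> \<le> dist u v}"

text \<open>The preimage under the quotient map is the union of \<open>W\<close> with its mirror
  image under swapping coordinates.\<close>

lemma openin_geodesics_from:
  assumes "open W" shows "openin geodesic_topology (geodesics_from W)"
proof -
  have "geodesics_from W \<subseteq> geodesics"
    by (auto simp: geodesics_from_def geodesics_def ordered_geodesics_def)
  moreover have "{(u, v) \<in> ordered_geodesics. Upair u v \<in> geodesics_from W} =
    ordered_geodesics \<inter> (W \<union> prod.swap -` W)"
    by (auto simp: Upair_in_geodesics_from Upair_in_geodesics ordered_geodesics_def)
  moreover have "open (prod.swap -` W)"
    using assms by (intro open_vimage) (auto simp: prod.swap_def intro!: continuous_intros)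
  ultimately show ?thesis using assms by (simp add: openin_geodesic_topology openin_open_Int open_Un)
qed

text \<open>An arbitrary choice: reversing it negates all values of \<open>side_sign \<gamma>\<close>, and only expressions
  invariant under this are used.\<close>

definition orientation :: "complex uprod \<Rightarrow> complex \<times> complex" where
  "orientation \<gamma> = (SOME (u, v). \<gamma> = Upair u v)"

definition side_sign :: "complex uprod \<Rightarrow> complex \<Rightarrow> real" where
  "side_sign \<gamma> p = sgn (side (fst (orientation \<gamma>)) (snd (orientation \<gamma>)) p)"

lemma Upair_orientation: "Upair (fst (orientation \<gamma>)) (snd (orientation \<gamma>)) = \<gamma>"
proof -
  obtain u v where "\<gamma> = Upair u v" by (cases \<gamma>)
  then have "\<exists>z. case z of (u, v) \<Rightarrow> \<gamma> = Upair u v" by auto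
  from someI_ex[OF this] show ?thesis unfolding orientation_def by (auto split: prod.splits)
qed

lemma side_sign_Upair:
  obtains "\<And>p. side_sign (Upair u v) p = sgn (side u v p)"
  | "\<And>p. side_sign (Upair u v) p = - sgn (side u v p)"
  using Upair_orientation[of "Upair u v"] side_swap[of u v]
  unfolding side_sign_def by (auto simp: sgn_minus)

lemma side_sign_product:
  "side_sign (Upair u v) x * side_sign (Upair u v) y < 0 \<longleftrightarrow> side u v x * side u v y < 0"
  "side_sign (Upair u v) x = 0 \<longleftrightarrow> side u v x = 0"
  by (rule side_sign_Upair[of u v]; auto simp: sgn_mult[symmetric] sgn_0_0)+

lemma side_sign_values: "side_sign \<gamma> x \<in> {-1, 0, 1}"
  by (auto simp: side_sign_def sgn_if)

section \<open>Transversality read off from the signs at the ends of a segment\<close>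

text \<open>Along the segment the side is affine, running from its value at \<open>x\<close> to its
  value at \<open>y\<close>. It has exactly one zero before \<open>y\<close> iff it changes sign
  strictly or vanishes at \<open>x\<close> only; when both end values vanish, a nondegenerate
  segment lies in the geodesic.\<close>

lemma transverse_half_open:
  assumes "x \<in> hyp_plane" "y \<in> hyp_plane"
  shows "transverse_geodesics (hyp_segment x y - {y}) =
    {\<gamma> \<in> geodesics. side_sign \<gamma> x * side_sign \<gamma> y < 0 \<or> side_sign \<gamma> x = 0 \<and> side_sign \<gamma> y \<noteq> 0}"
proof -
  have "(\<exists>p. geodesic_line \<gamma> \<inter> (hyp_segment x y - {y}) = {p}) \<longleftrightarrow>
     side_sign \<gamma> x * side_sign \<gamma> y < 0 \<or> side_sign \<gamma> x = 0 \<and> side_sign \<gamma> y \<noteq> 0" if "\<gamma> \<in> geodesics" for \<gamma>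
  proof -
    from that obtain u v where uv: "\<gamma> = Upair u v" "u \<in> sphere 0 1" "v \<in> sphere 0 1" "u \<noteq> v"
      unfolding geodesics_def by blast
    define X Y where "X = side u v x" and "Y = side u v y"
    define h where "h t = (1 - t) *\<^sub>R x + t *\<^sub>R y" for t
    have line: "geodesic_line \<gamma> = {p \<in> ball 0 1. side u v p = 0}"
      using side_eq_0_iff_segment[OF uv(2-4)] by (auto simp: geodesic_line_def uv(1) segment_convex_hull)
    have seg: "hyp_segment x y = closed_segment x y" "closed_segment x y \<subseteq> ball 0 1"
      using assms by (auto simp: hyp_segment_eq_closed_segment closed_segment_subset)
    have h: "side u v (h t) = (1 - t) * X + t * Y" for t by (simp only: h_def side_affine X_def Y_def)
    have seg_h: "closed_segment x y = h ` {0..1}" unfolding h_def closed_segment_image_interval ..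
    have "(\<exists>p. geodesic_line \<gamma> \<inter> (hyp_segment x y - {y}) = {p}) \<longleftrightarrow> X * Y < 0 \<or> X = 0 \<and> Y \<noteq> 0"
    proof (cases "x = y")
      case True
      then show ?thesis using seg by (auto simp: X_def Y_def mult_less_0_iff)
    next
      case False
      have inj: "h s = h t \<longleftrightarrow> s = t" for s t
      proof -
        have "h s - h t = (s - t) *\<^sub>R (y - x)" by (simp add: h_def algebra_simps)
        then show ?thesis using False by (metis eq_iff_diff_eq_0 scaleR_eq_0_iff)
      qed
      have "h 1 = y" by (simp add: h_def)
      then have "closed_segment x y - {y} = h ` {0..<1}"
        unfolding seg_h using inj by (force simp: image_iff)
      then have seg': "hyp_segment x y - {y} = h ` {0..<1}" by (simp only: seg(1))
      have "h ` {0..<1} \<subseteq> ball 0 1" using seg(2) unfolding seg_h by auto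
      then have eq: "geodesic_line \<gamma> \<inter> (hyp_segment x y - {y}) = h ` {t \<in> {0..<1}. (1 - t) * X + t * Y = 0}"
        unfolding line seg' h[symmetric] by blast
      show ?thesis
      proof (cases "X = Y")
        case True
        then have "(1 - t) * X + t * Y = X" for t by (simp add: algebra_simps)
        then have eq': "geodesic_line \<gamma> \<inter> (hyp_segment x y - {y}) = (if X = 0 then h ` {0..<1} else {})"
          unfolding eq by auto
        \<comment> \<open>A constant side is either nonzero throughout or zero at more than one
          point, so the intersection is never a singleton.\<close>
        have "h 0 \<noteq> h (1/2)" using inj by simp
        moreover have "h 0 \<in> h ` {0..<1}" "h (1/2) \<in> h ` {0..<1}" by simp_all
        ultimately have "h ` {0..<1} \<noteq> {p}" for p by (metis singletonD)
        then show ?thesis unfolding eq' using True by (auto simp: mult_less_0_iff)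
      next
        case False
        \<comment> \<open>Distinct end values leave one root; it remains to decide whether it lies
          in \<open>{0..<1}\<close>.\<close>
        have "(1 - t) * X + t * Y = 0 \<longleftrightarrow> t = X / (X - Y)" for t
          using False by (auto simp: eq_divide_eq algebra_simps)
        then have eq': "geodesic_line \<gamma> \<inter> (hyp_segment x y - {y}) = h ` ({0..<1} \<inter> {X / (X - Y)})"
          unfolding eq by auto
        have "(\<exists>p. geodesic_line \<gamma> \<inter> (hyp_segment x y - {y}) = {p}) \<longleftrightarrow> X / (X - Y) \<in> {0..<1}"
          unfolding eq' by (cases "X / (X - Y) \<in> {0..<1}") auto
        also have "\<dots> \<longleftrightarrow> X * Y < 0 \<or> X = 0 \<and> Y \<noteq> 0"
          using False by (cases "X < Y") (auto simp: divide_simps mult_less_0_iff)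
        finally show ?thesis .
      qed
    qed
    then show ?thesis using side_sign_product[of u v] by (simp add: uv(1) X_def Y_def)
  qed
  then show ?thesis unfolding transverse_geodesics_def by blast
qed

lemma hyp_segment_commute: "hyp_segment x y = hyp_segment y x"
  by (auto simp: hyp_segment_def hyp_dist_def inner_commute mult.commute add.commute)

text \<open>The segment stays in a disc of radius below 1, and a chord reaching that disc cannot be
  short.\<close>

lemma transverse_half_open_chord:
  assumes "x \<in> hyp_plane" "y \<in> hyp_plane"
  obtains \<epsilon> where "\<epsilon> > 0"
    "transverse_geodesics (hyp_segment x y - {y}) \<subseteq> long_chords \<epsilon>"
proof
  define r where "r = max (norm x) (norm y)"
  show "2 * (1 - r) > 0" using assms by (simp add: r_def)
  show "transverse_geodesics (hyp_segment x y - {y}) \<subseteq> long_chords (2 * (1 - r))"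
  proof
    fix \<gamma> assume "\<gamma> \<in> transverse_geodesics (hyp_segment x y - {y})"
    then have \<gamma>: "\<gamma> \<in> geodesics" "\<exists>p. p \<in> geodesic_line \<gamma> \<and> p \<in> hyp_segment x y"
      unfolding transverse_geodesics_def by auto
    from \<gamma>(1) obtain u v where uv: "\<gamma> = Upair u v" "u \<in> sphere 0 1" "v \<in> sphere 0 1"
      unfolding geodesics_def by blast
    from \<gamma>(2) obtain p where p: "p \<in> closed_segment u v" "p \<in> hyp_segment x y"
      unfolding uv(1) geodesic_line_def set_uprod_simps segment_convex_hull by blast
    have "closed_segment x y \<subseteq> cball 0 r"
      by (intro closed_segment_subset convex_cball) (auto simp: r_def)
    then have "norm p \<le> r" using p(2) unfolding hyp_segment_eq_closed_segment[OF assms] by auto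
    then show "\<gamma> \<in> long_chords (2 * (1 - r))"
      using chord_length_ge[OF uv(2,3) p(1)] uv unfolding long_chords_def by blast
  qed
qed

lemma current_dist_nonneg: "0 \<le> current_dist \<mu> x y"
  by (simp add: current_dist_def)

lemma current_dist_commute: "current_dist \<mu> x y = current_dist \<mu> y x"
  by (simp add: current_dist_def hyp_segment_commute[of x])

context geodesic_current
begin

lemma space_current: "space \<mu> = geodesics"
  and open_measurable: "openin geodesic_topology U \<Longrightarrow> U \<in> sets \<mu>"
proof -
  have *: "{U. openin geodesic_topology U} \<subseteq> Pow geodesics"
    using openin_subset topspace_geodesic_topology by blast
  show "space \<mu> = geodesics"
    using sets_eq_imp_space_eq[OF borel] * by (simp add: space_measure_of)
  show "U \<in> sets \<mu>" if "openin geodesic_topology U"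
    unfolding borel using that * by (simp add: sets_measure_of)
qed

lemma geodesics_from_measurable: "open W \<Longrightarrow> geodesics_from W \<in> sets \<mu>"
  by (intro open_measurable openin_geodesics_from)

section \<open>Finiteness of the measures and the integral formula for the distance\<close>

text \<open>Chords of length at least \<open>\<epsilon>\<close> form a compact set, the continuous
  image of a compact set of ordered pairs. Local finiteness then yields a finite open cover of
  finite measure, whose union serves as \<open>U\<close>.\<close>

lemma long_chords_finite:
  assumes "\<epsilon> > 0"
  obtains U where "U \<in> sets \<mu>" "emeasure \<mu> U < \<infinity>"
    "long_chords \<epsilon> \<subseteq> U"
proof -
  define C where "C = (sphere 0 1 \<times> sphere 0 1) \<inter> {(u, v). \<epsilon> \<le> dist u (v::complex)}"
  let ?L = "long_chords \<epsilon>"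
  have "closed {(u, v). \<epsilon> \<le> dist u (v::complex)}"
    unfolding case_prod_unfold by (intro closed_Collect_le continuous_intros)
  then have "compact C" unfolding C_def by (intro compact_Int_closed compact_Times compact_sphere)
  moreover have "C \<subseteq> ordered_geodesics" using assms by (auto simp: C_def ordered_geodesics_def)
  ultimately have "compactin (top_of_set ordered_geodesics) C" by (simp add: compactin_subtopology)
  then have "compactin geodesic_topology ((\<lambda>(u, v). Upair u v) ` C)"
    by (rule image_compactin[OF _ quotient_imp_continuous_map[OF quotient_map_geodesic_topology]])
  also have "(\<lambda>(u, v). Upair u v) ` C = ?L" by (force simp: C_def long_chords_def)
  finally have c: "compactin geodesic_topology ?L" .
  let ?\<U> = "{U. openin geodesic_topology U \<and> emeasure \<mu> U < \<infinity>}"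
  have "?L \<subseteq> \<Union>?\<U>"
  proof
    fix \<gamma> assume "\<gamma> \<in> ?L"
    then have "\<gamma> \<in> geodesics" using c topspace_geodesic_topology compactin_subset_topspace by blast
    then show "\<gamma> \<in> \<Union>?\<U>" using locally_finite by blast
  qed
  then obtain F where F: "finite F" "F \<subseteq> ?\<U>" "?L \<subseteq> \<Union>F"
    using compactinD[OF c, of ?\<U>] by blast
  have "emeasure \<mu> (\<Union>F) \<le> (\<Sum>U\<in>F. emeasure \<mu> U)"
    using F emeasure_subadditive_finite[of F id \<mu>] open_measurable by (auto simp: subset_iff)
  also have "\<dots> < \<infinity>" using F by (simp add: subset_iff)
  finally show ?thesis using that[of "\<Union>F"] F open_measurable by (auto intro!: sets.finite_Union)
qed

lemma transverse_measurable:
  assumes "x \<in> hyp_plane" "y \<in> hyp_plane"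
  shows "transverse_geodesics (hyp_segment x y - {y}) \<in> sets \<mu>"
    and "emeasure \<mu> (transverse_geodesics (hyp_segment x y - {y})) < \<infinity>"
proof -
  \<comment> \<open>Only nonvanishing and opposite signs are open conditions, so the case of a zero
    at \<open>x\<close> enters as a complement.\<close>
  have "transverse_geodesics (hyp_segment x y - {y}) =
    geodesics_from {(u, v). side u v x * side u v y < 0} \<union>
    (geodesics_from {(u, v). side u v y \<noteq> 0} - geodesics_from {(u, v). side u v x \<noteq> 0})"
  proof (rule set_eqI)
    fix \<gamma> :: "complex uprod"
    obtain u v where "\<gamma> = Upair u v" by (cases \<gamma>)
    then show "\<gamma> \<in> transverse_geodesics (hyp_segment x y - {y}) \<longleftrightarrow> \<gamma> \<in> geodesics_from {(u, v). side u v x * side u v y < 0} \<union>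
        (geodesics_from {(u, v). side u v y \<noteq> 0} - geodesics_from {(u, v). side u v x \<noteq> 0})"
      unfolding transverse_half_open[OF assms] using side_swap[of u v]
      by (auto simp: side_sign_product Upair_in_geodesics_from)
  qed
  moreover have "open {(u, v). side u v x * side u v y < 0}" "open {(u, v). side u v x \<noteq> 0}" "open {(u, v). side u v y \<noteq> 0}"
    unfolding case_prod_unfold by (intro open_Collect_less open_Collect_neq continuous_intros)+
  ultimately show m: "transverse_geodesics (hyp_segment x y - {y}) \<in> sets \<mu>"
    by (auto intro!: geodesics_from_measurable)
  show "emeasure \<mu> (transverse_geodesics (hyp_segment x y - {y})) < \<infinity>"
    using transverse_half_open_chord[OF assms] long_chords_finite emeasure_mono order_le_less_trans subset_trans
    by metis
qed

text \<open>A geodesic strictly separating \<open>x\<close> from \<open>y\<close> is counted by both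
  half-open segments, one through exactly one of the points by a single segment, all others by none:
  this is the absolute difference of the signs.\<close>

lemma current_dist_integral:
  assumes "x \<in> hyp_plane" "y \<in> hyp_plane"
  shows "has_bochner_integral \<mu> (\<lambda>\<gamma>. \<bar>side_sign \<gamma> x - side_sign \<gamma> y\<bar> / 2) (current_dist \<mu> x y)"
proof -
  let ?A = "transverse_geodesics (hyp_segment x y - {y})" and ?B = "transverse_geodesics (hyp_segment y x - {x})"
  have "has_bochner_integral \<mu> (\<lambda>\<gamma>. (indicator ?A \<gamma> + indicator ?B \<gamma>) / 2) ((measure \<mu> ?A + measure \<mu> ?B) / 2)"
    using transverse_measurable assms
    by (intro has_bochner_integral_divide has_bochner_integral_add has_bochner_integral_real_indicator)
  then show ?thesis unfolding current_dist_def hyp_segment_commute[of y x]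
  proof (rule has_bochner_integral_cong[THEN iffD1, rotated 3])
    fix \<gamma> assume "\<gamma> \<in> space \<mu>"
    then show "(indicator ?A \<gamma> + indicator (transverse_geodesics (hyp_segment x y - {x})) \<gamma>) / 2 = \<bar>side_sign \<gamma> x - side_sign \<gamma> y\<bar> / 2"
      using side_sign_values[of \<gamma> x] side_sign_values[of \<gamma> y]
      unfolding transverse_half_open[OF assms] transverse_half_open[OF assms(2,1), unfolded hyp_segment_commute[of y x]] space_current
      by (auto simp: indicator_def)
  qed auto
qed

text \<open>Integrating a pointwise inequality between signs reduces four-point estimates to finite
  case checks. The coefficient \<open>c\<close> is 0 for the triangle inequality, 2 for the upper
  and -2 for the lower bound.\<close>

lemma current_dist_mono:
  assumes "x \<in> hyp_plane" "y \<in> hyp_plane" "z \<in> hyp_plane" "w \<in> hyp_plane"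
    "x' \<in> hyp_plane" "y' \<in> hyp_plane" "z' \<in> hyp_plane" "w' \<in> hyp_plane"
    "A \<in> sets \<mu>" "emeasure \<mu> A < \<infinity>"
    and le: "\<And>\<gamma>. \<gamma> \<in> geodesics \<Longrightarrow> \<bar>side_sign \<gamma> x - side_sign \<gamma> y\<bar> / 2 + \<bar>side_sign \<gamma> z - side_sign \<gamma> w\<bar> / 2 \<le>
      \<bar>side_sign \<gamma> x' - side_sign \<gamma> y'\<bar> / 2 + \<bar>side_sign \<gamma> z' - side_sign \<gamma> w'\<bar> / 2 + c * indicator A \<gamma>"
  shows "current_dist \<mu> x y + current_dist \<mu> z w \<le> current_dist \<mu> x' y' + current_dist \<mu> z' w' + c * measure \<mu> A"
proof -
  have 1: "has_bochner_integral \<mu> (\<lambda>\<gamma>. \<bar>side_sign \<gamma> x - side_sign \<gamma> y\<bar> / 2 + \<bar>side_sign \<gamma> z - side_sign \<gamma> w\<bar> / 2)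
     (current_dist \<mu> x y + current_dist \<mu> z w)"
    using assms by (intro has_bochner_integral_add current_dist_integral)
  have 2: "has_bochner_integral \<mu> (\<lambda>\<gamma>. \<bar>side_sign \<gamma> x' - side_sign \<gamma> y'\<bar> / 2 + \<bar>side_sign \<gamma> z' - side_sign \<gamma> w'\<bar> / 2 + c * indicator A \<gamma>)
     (current_dist \<mu> x' y' + current_dist \<mu> z' w' + c * measure \<mu> A)"
    using assms by (intro has_bochner_integral_add current_dist_integral has_bochner_integral_mult_right has_bochner_integral_real_indicator)
  show ?thesis
    unfolding has_bochner_integral_integral_eq[OF 1, symmetric] has_bochner_integral_integral_eq[OF 2, symmetric]
    using 1 2 le by (intro integral_mono) (auto simp: has_bochner_integral_iff space_current)
qed

lemma current_dist_self: "x \<in> hyp_plane \<Longrightarrow> current_dist \<mu> x x = 0"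
  using current_dist_integral[of x x] by (simp add: has_bochner_integral_iff)

lemma current_dist_triangle:
  assumes "x \<in> hyp_plane" "y \<in> hyp_plane" "z \<in> hyp_plane"
  shows "current_dist \<mu> x z \<le> current_dist \<mu> x y + current_dist \<mu> y z"
  using current_dist_mono[of x z x x x y y z "{}" 0] current_dist_self assms by simp

section \<open>Measurability of boxes\<close>

lemma box_compact_measurable:
  assumes "compact I" "compact J" "I \<subseteq> hyp_boundary" "J \<subseteq> hyp_boundary" "I \<inter> J = {}"
  shows "box I J \<in> sets \<mu>"
proof -
  \<comment> \<open>The complement of the symmetrised product is open, so the box is the complement
    of an open set of geodesics.\<close>
  define W where "W = - (I \<times> J \<union> J \<times> I)"
  have "open W" unfolding W_def using assms
    by (intro open_Compl closed_Un compact_imp_closed compact_Times)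
  moreover have "box I J = geodesics - geodesics_from W"
  proof (rule set_eqI)
    fix \<gamma> :: "complex uprod"
    show "\<gamma> \<in> box I J \<longleftrightarrow> \<gamma> \<in> geodesics - geodesics_from W"
      using assms(3-5) by (cases \<gamma>) (auto simp: Upair_in_box Upair_in_geodesics Upair_in_geodesics_from W_def)
  qed
  ultimately show ?thesis
    using geodesics_from_measurable space_current sets.compl_sets by metis
qed

lemma box_exhaustion:
  assumes "I \<in> circle_intervals s t" "J \<in> circle_intervals s' t'" "I \<inter> J = {}"
  obtains \<alpha> \<beta> \<alpha>' \<beta>' :: "nat \<Rightarrow> real"
  where "\<And>n. s \<le> \<alpha> n" "\<And>n. \<beta> n \<le> t" "\<And>n. s' \<le> \<alpha>' n" "\<And>n. \<beta>' n \<le> t'"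
    "\<And>n. cis ` {\<alpha> n..\<beta> n} \<subseteq> I" "\<And>n. cis ` {\<alpha>' n..\<beta>' n} \<subseteq> J"
    "\<And>n. box (cis ` {\<alpha> n..\<beta> n}) (cis ` {\<alpha>' n..\<beta>' n}) \<in> sets \<mu>"
    "incseq (\<lambda>n. box (cis ` {\<alpha> n..\<beta> n}) (cis ` {\<alpha>' n..\<beta>' n}))"
    "box I J = (\<Union>n. box (cis ` {\<alpha> n..\<beta> n}) (cis ` {\<alpha>' n..\<beta>' n}))"
proof -
  obtain \<alpha> \<beta> :: "nat \<Rightarrow> real" where 1: "decseq \<alpha>" "incseq \<beta>" "\<And>n. s \<le> \<alpha> n" "\<And>n. \<beta> n \<le> t"
    and I: "I = (\<Union>n. cis ` {\<alpha> n..\<beta> n})" by (rule circle_interval_exhaustion[OF assms(1)]) blast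
  obtain \<alpha>' \<beta>' :: "nat \<Rightarrow> real" where 2: "decseq \<alpha>'" "incseq \<beta>'" "\<And>n. s' \<le> \<alpha>' n" "\<And>n. \<beta>' n \<le> t'"
    and J: "J = (\<Union>n. cis ` {\<alpha>' n..\<beta>' n})" by (rule circle_interval_exhaustion[OF assms(2)]) blast
  let ?I = "\<lambda>n. cis ` {\<alpha> n..\<beta> n}" and ?J = "\<lambda>n. cis ` {\<alpha>' n..\<beta>' n}"
  have inc: "?I n \<subseteq> ?I m" "?J n \<subseteq> ?J m" if "n \<le> m" for n m
    using decseqD[OF 1(1) that] incseqD[OF 1(2) that] decseqD[OF 2(1) that] incseqD[OF 2(2) that]
    by (auto intro!: image_mono)
  have sub: "?I n \<subseteq> I" "?J n \<subseteq> J" for n using I J by auto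
  have "box (?I n) (?J n) \<in> sets \<mu>" for n
    using sub[of n] assms(3)
    by (intro box_compact_measurable compact_continuous_image continuous_intros) auto
  moreover have "incseq (\<lambda>n. box (?I n) (?J n))" unfolding incseq_def by (intro allI impI box_mono inc)
  moreover have "box I J = (\<Union>n. box (?I n) (?J n))"
  proof (intro equalityI subsetI)
    fix \<gamma> assume "\<gamma> \<in> box I J"
    then obtain u v n m where "\<gamma> = Upair u v" "u \<in> ?I n" "v \<in> ?J m"
      unfolding box_def I J by blast
    \<comment> \<open>The two ends may appear at different stages; the later stage contains
      both.\<close>
    moreover have "?I n \<subseteq> ?I (max n m)" "?J m \<subseteq> ?J (max n m)" by (intro inc; simp)+
    ultimately have "\<gamma> \<in> box (?I (max n m)) (?J (max n m))" unfolding box_def by blast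
    then show "\<gamma> \<in> (\<Union>n. box (?I n) (?J n))" by blast
  next
    fix \<gamma> assume "\<gamma> \<in> (\<Union>n. box (?I n) (?J n))"
    then show "\<gamma> \<in> box I J" using box_mono[OF sub] by blast
  qed
  ultimately show ?thesis using that 1(3,4) 2(3,4) sub by blast
qed

lemma opposite_boxes_measurable:
  assumes "(B, B') \<in> opposite_boxes" shows "B \<in> sets \<mu>" "B' \<in> sets \<mu>"
proof -
  have m: "box I J \<in> sets \<mu>" if IJ: "I \<in> circle_intervals s t" "J \<in> circle_intervals s' t'" "I \<inter> J = {}" for I J s t s' t'
    by (rule box_exhaustion[OF IJ]) auto
  obtain I1 I2 I3 I4 a b c d where "B = box I1 I3" "B' = box I4 I2" "I1 \<in> circle_intervals a b" "I2 \<in> circle_intervals b c"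
    "I3 \<in> circle_intervals c d" "I4 \<in> circle_intervals d (a + 2 * pi)" "I1 \<inter> I3 = {}" "I2 \<inter> I4 = {}"
    using assms unfolding opposite_boxes_def by auto
  then show "B \<in> sets \<mu>" "B' \<in> sets \<mu>" using m[of I1 a b I3 c d] m[of I4 d _ I2 b c] by (auto simp: Int_commute)
qed

end

section \<open>Deck transformations and the four-point condition\<close>

context closed_hyperbolic_surface
begin

section \<open>Deck transformations on the closed disc\<close>

text \<open>The image of the closed disc is compact and contains the open disc, hence also its
  closure; outside the closed disc the map is the identity.\<close>

lemma deck_surj:
  assumes "g \<in> \<Gamma>" shows "surj g"
proof -
  have g: "g ` hyp_plane = hyp_plane" "continuous_on (cball 0 1) g" "\<And>x. x \<notin> cball 0 1 \<Longrightarrow> g x = x"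
    using isometries[OF assms] unfolding orientation_preserving_isometry_def by blast+
  have "compact (g ` cball 0 1)" using g(2) by (intro compact_continuous_image) auto
  moreover have "hyp_plane \<subseteq> g ` cball 0 1" using g(1) ball_subset_cball by blast
  ultimately have "closure hyp_plane \<subseteq> g ` cball 0 1"
    by (intro closure_minimal compact_imp_closed)
  then have "cball 0 1 \<subseteq> g ` cball 0 1" by simp
  then show ?thesis using g(3) by (metis rangeI subsetD surjI surj_def image_iff)
qed

text \<open>Injectivity comes from the surjectivity of \<open>inv g\<close>, which is itself a deck
  transformation.\<close>

lemma deck_inv:
  assumes "g \<in> \<Gamma>" shows "inv g (g x) = x"
proof -
  obtain y where y: "x = inv g y" using deck_surj[OF inv_mem[OF assms]] by (rule surjE)
  show ?thesis unfolding y using surj_f_inv_f[OF deck_surj[OF assms]] by simp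
qed

lemma deck_boundary:
  assumes "g \<in> \<Gamma>" "u \<in> hyp_boundary" shows "g u \<in> hyp_boundary"
proof -
  have g: "g ` hyp_plane = hyp_plane" "continuous_on (cball 0 1) g"
    using isometries[OF assms(1)] unfolding orientation_preserving_isometry_def by blast+
  have "inv g ` hyp_plane = hyp_plane"
    using isometries[OF inv_mem[OF assms(1)]] unfolding orientation_preserving_isometry_def by blast
  \<comment> \<open>Otherwise \<open>inv g\<close> would carry \<open>g u\<close> back into the open
    disc, although the result is \<open>u\<close>.\<close>
  then have "g u \<notin> hyp_plane" using deck_inv[OF assms(1), of u] assms(2)
    by (metis imageI mem_ball_0 mem_sphere_0 less_irrefl)
  moreover have "g ` closure hyp_plane \<subseteq> cball 0 1"
    using g by (intro image_closure_subset) (auto simp: ball_subset_cball)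
  then have "g u \<in> cball 0 1" using assms(2) by (auto simp: subset_iff)
  ultimately show ?thesis by auto
qed

lemma deck_plane: "g \<in> \<Gamma> \<Longrightarrow> x \<in> hyp_plane \<Longrightarrow> g x \<in> hyp_plane"
  using isometries unfolding orientation_preserving_isometry_def by blast

lemma deck_side_sgn:
  assumes "g \<in> \<Gamma>" "u \<in> hyp_boundary" "v \<in> hyp_boundary" "p \<in> cball 0 1"
  shows "sgn (side (g u) (g v) (g p)) = sgn (side u v p)"
proof -
  have *: "side (h a) (h b) (h c) > 0" if "h \<in> \<Gamma>" "a \<in> cball 0 1" "b \<in> cball 0 1" "c \<in> cball 0 1" "side a b c > 0" for h a b c
    using isometries[OF that(1)] that(2-) unfolding orientation_preserving_isometry_def ccw_iff_side by blast
  have cb: "u \<in> cball 0 1" "v \<in> cball 0 1" "g u \<in> cball 0 1" "g v \<in> cball 0 1"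
    using assms deck_boundary[OF assms(1)] by auto
  have "p \<in> hyp_plane \<or> p \<in> hyp_boundary" using assms(4) by auto
  then have gp: "g p \<in> cball 0 1" using deck_boundary[OF assms(1)] deck_plane[OF assms(1)] by force
  note gi = inv_mem[OF assms(1)]
  show ?thesis
  proof (cases "side u v p" "0::real" rule: linorder_cases)
    case greater
    then show ?thesis using *[OF assms(1) cb(1,2) assms(4)] by simp
  next
    case less
    then show ?thesis using *[OF assms(1) cb(2,1) assms(4)] side_swap[of u v] side_swap[of "g u" "g v"] by simp
  next
    \<comment> \<open>A nonzero side of the images would remain nonzero after applying the
      orientation-preserving inverse.\<close>
    case equal
    then show ?thesis
      using *[OF gi cb(3,4) gp] *[OF gi cb(4,3) gp] side_swap[of u v] side_swap[of "g u" "g v"] deck_inv[OF assms(1)]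
      by (cases "side (g u) (g v) (g p)" "0::real" rule: linorder_cases) auto
  qed
qed

text \<open>The translates of a compact set cover the plane; \<open>r\<close> is the largest norm on
  that set.\<close>

lemma deck_into_compact:
  obtains r where "r < 1" "\<And>p. p \<in> hyp_plane \<Longrightarrow> \<exists>g\<in>\<Gamma>. norm (g p) \<le> r"
proof -
  obtain K where K: "K \<subseteq> hyp_plane" "compact K" "(\<Union>g\<in>\<Gamma>. g ` K) = hyp_plane" using cocompact by blast
  have "0 \<in> hyp_plane" by simp
  then have "K \<noteq> {}" using K(3) by blast
  then obtain k where k: "k \<in> K" "\<And>x. x \<in> K \<Longrightarrow> norm x \<le> norm k"
    using continuous_attains_sup[OF K(2), of norm] continuous_on_norm_id by blast
  have "\<exists>g\<in>\<Gamma>. norm (g p) \<le> norm k" if "p \<in> hyp_plane" for p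
  proof -
    from that have "p \<in> (\<Union>g\<in>\<Gamma>. g ` K)" by (simp only: K(3))
    then obtain g x where "g \<in> \<Gamma>" "x \<in> K" "p = g x" by blast
    then have "norm (inv g p) \<le> norm k" using deck_inv k(2) by simp
    then show ?thesis using inv_mem \<open>g \<in> \<Gamma>\<close> by blast
  qed
  then show ?thesis using that[of "norm k"] k(1) K(1) by auto
qed

end

section \<open>Compact arcs inside opposite boxes and finiteness of the supremum\<close>

text \<open>Continuity from below allows closed arcs of measure still above \<open>m\<close>.
  Disjoint closed arcs leave gaps, and corners chosen in the gaps lie strictly on one side of every
  chord joining opposite arcs.\<close>

lemma opposite_boxes_refine:
  assumes "geodesic_current \<Gamma> \<mu>" "(B, B') \<in> opposite_boxes" "m < min (emeasure \<mu> B) (emeasure \<mu> B')"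
  obtains a b c d C1 C2 C3 C4 where "a < b" "b < c" "c < d" "d < a + 2 * pi"
    "compact C1" "compact C2" "compact C3" "compact C4"
    "C1 \<subseteq> sphere 0 1" "C2 \<subseteq> sphere 0 1" "C3 \<subseteq> sphere 0 1" "C4 \<subseteq> sphere 0 1"
    "\<And>u v. u \<in> C1 \<Longrightarrow> v \<in> C3 \<Longrightarrow> side u v (cis b) < 0 \<and> side u v (cis c) < 0 \<and> side u v (cis a) > 0 \<and> side u v (cis d) > 0"
    "\<And>u v. u \<in> C2 \<Longrightarrow> v \<in> C4 \<Longrightarrow> side u v (cis c) < 0 \<and> side u v (cis d) < 0 \<and> side u v (cis a) > 0 \<and> side u v (cis b) > 0"
    "box C1 C3 \<in> sets \<mu>" "box C2 C4 \<in> sets \<mu>" "m < emeasure \<mu> (box C1 C3)" "m < emeasure \<mu> (box C2 C4)"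
proof -
  interpret geodesic_current \<Gamma> \<mu> by fact
  obtain I1 I2 I3 I4 a b c d where B: "B = box I1 I3" "B' = box I4 I2" and I: "I1 \<in> circle_intervals a b" "I2 \<in> circle_intervals b c"
    "I3 \<in> circle_intervals c d" "I4 \<in> circle_intervals d (a + 2 * pi)"
    and disj: "I1 \<inter> I2 = {}" "I1 \<inter> I3 = {}" "I1 \<inter> I4 = {}" "I2 \<inter> I3 = {}" "I2 \<inter> I4 = {}" "I3 \<inter> I4 = {}"
    using assms(2) unfolding opposite_boxes_def by auto
  obtain \<alpha>1 \<beta>1 \<alpha>3 \<beta>3 :: "nat \<Rightarrow> real" where
    13: "\<And>n. a \<le> \<alpha>1 n" "\<And>n. \<beta>1 n \<le> b" "\<And>n. c \<le> \<alpha>3 n" "\<And>n. \<beta>3 n \<le> d"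
      "\<And>n. cis ` {\<alpha>1 n..\<beta>1 n} \<subseteq> I1" "\<And>n. cis ` {\<alpha>3 n..\<beta>3 n} \<subseteq> I3"
      "\<And>n. box (cis ` {\<alpha>1 n..\<beta>1 n}) (cis ` {\<alpha>3 n..\<beta>3 n}) \<in> sets \<mu>"
      "incseq (\<lambda>n. box (cis ` {\<alpha>1 n..\<beta>1 n}) (cis ` {\<alpha>3 n..\<beta>3 n}))"
      "box I1 I3 = (\<Union>n. box (cis ` {\<alpha>1 n..\<beta>1 n}) (cis ` {\<alpha>3 n..\<beta>3 n}))"
  proof (rule box_exhaustion[OF I(1,3) disj(2)], goal_cases)
    case 1
    show ?case by (rule 1(1)[OF 1(2-10)])
  qed
  obtain \<alpha>2 \<beta>2 \<alpha>4 \<beta>4 :: "nat \<Rightarrow> real" where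
    24: "\<And>n. b \<le> \<alpha>2 n" "\<And>n. \<beta>2 n \<le> c" "\<And>n. d \<le> \<alpha>4 n" "\<And>n. \<beta>4 n \<le> a + 2 * pi"
      "\<And>n. cis ` {\<alpha>2 n..\<beta>2 n} \<subseteq> I2" "\<And>n. cis ` {\<alpha>4 n..\<beta>4 n} \<subseteq> I4"
      "\<And>n. box (cis ` {\<alpha>2 n..\<beta>2 n}) (cis ` {\<alpha>4 n..\<beta>4 n}) \<in> sets \<mu>"
      "incseq (\<lambda>n. box (cis ` {\<alpha>2 n..\<beta>2 n}) (cis ` {\<alpha>4 n..\<beta>4 n}))"
      "box I2 I4 = (\<Union>n. box (cis ` {\<alpha>2 n..\<beta>2 n}) (cis ` {\<alpha>4 n..\<beta>4 n}))"
  proof (rule box_exhaustion[OF I(2,4) disj(5)], goal_cases)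
    case 1
    show ?case by (rule 1(1)[OF 1(2-10)])
  qed
  let ?B = "\<lambda>n. box (cis ` {\<alpha>1 n..\<beta>1 n}) (cis ` {\<alpha>3 n..\<beta>3 n})"
  let ?B' = "\<lambda>n. box (cis ` {\<alpha>2 n..\<beta>2 n}) (cis ` {\<alpha>4 n..\<beta>4 n})"
  have "m < (SUP n. emeasure \<mu> (?B n))" "m < (SUP n. emeasure \<mu> (?B' n))"
    using assms(3) 13(7-) 24(7-) unfolding B box_commute[of I4] by (auto simp: SUP_emeasure_incseq image_subset_iff)
  then obtain n1 n2 where "m < emeasure \<mu> (?B n1)" "m < emeasure \<mu> (?B' n2)" by (auto simp: less_SUP_iff)
  define n where "n = max n1 n2"
  have m: "m < emeasure \<mu> (?B n)" "m < emeasure \<mu> (?B' n)"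
  proof -
    have "emeasure \<mu> (?B n1) \<le> emeasure \<mu> (?B n)" "emeasure \<mu> (?B' n2) \<le> emeasure \<mu> (?B' n)"
      using 13(7) 24(7) incseqD[OF 13(8), of n1 n] incseqD[OF 24(8), of n2 n]
      by (auto intro!: emeasure_mono simp: n_def)
    then show "m < emeasure \<mu> (?B n)" "m < emeasure \<mu> (?B' n)"
      using \<open>m < emeasure \<mu> (?B n1)\<close> \<open>m < emeasure \<mu> (?B' n2)\<close> by auto
  qed
  \<comment> \<open>A measure above \<open>m\<close> is positive, so none of the four arcs is
    empty.\<close>
  have "?B n \<noteq> {}" "?B' n \<noteq> {}" using m by auto
  then have le: "\<alpha>1 n \<le> \<beta>1 n" "\<alpha>2 n \<le> \<beta>2 n" "\<alpha>3 n \<le> \<beta>3 n" "\<alpha>4 n \<le> \<beta>4 n" by (auto simp: box_def)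
  have mem: "cis (\<alpha>1 n) \<in> I1" "cis (\<beta>1 n) \<in> I1" "cis (\<alpha>2 n) \<in> I2" "cis (\<beta>2 n) \<in> I2"
    "cis (\<alpha>3 n) \<in> I3" "cis (\<beta>3 n) \<in> I3" "cis (\<alpha>4 n) \<in> I4" "cis (\<beta>4 n) \<in> I4"
    using 13(5,6)[of n] 24(5,6)[of n] le by auto
  have ne: "\<beta>1 n \<noteq> \<alpha>2 n" "\<beta>2 n \<noteq> \<alpha>3 n" "\<beta>3 n \<noteq> \<alpha>4 n" using mem disj by auto
  \<comment> \<open>The gap across the cut of the circle compares angles one full turn
    apart.\<close>
  have "cis (\<alpha>1 n + 2 * pi) = cis (\<alpha>1 n)" by (simp add: complex_eq_iff)
  then have "\<beta>4 n \<noteq> \<alpha>1 n + 2 * pi" using mem disj by auto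
  with ne have lt: "\<beta>1 n < \<alpha>2 n" "\<beta>2 n < \<alpha>3 n" "\<beta>3 n < \<alpha>4 n" "\<beta>4 n < \<alpha>1 n + 2 * pi"
    using 13(1-4)[of n] 24(1-4)[of n] by (smt (verit))+
  \<comment> \<open>Midpoints of the four gaps; the one across the cut is shifted down by a full
    turn.\<close>
  define a' b' c' d' where "a' = (\<beta>4 n - 2 * pi + \<alpha>1 n) / 2" and "b' = (\<beta>1 n + \<alpha>2 n) / 2"
    and "c' = (\<beta>2 n + \<alpha>3 n) / 2" and "d' = (\<beta>3 n + \<alpha>4 n) / 2"
  have o: "a' < \<alpha>1 n" "\<beta>1 n < b'" "b' < \<alpha>2 n" "\<beta>2 n < c'" "c' < \<alpha>3 n" "\<beta>3 n < d'" "d' < \<alpha>4 n" "\<beta>4 n < a' + 2 * pi"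
    using lt by (auto simp: a'_def b'_def c'_def d'_def field_simps)
  have cp: "compact (cis ` {s..t})" "cis ` {s..t} \<subseteq> sphere 0 1" for s t
    by (intro compact_continuous_image continuous_intros) auto
  show ?thesis
  proof (rule that[of a' b' c' d' "cis ` {\<alpha>1 n..\<beta>1 n}" "cis ` {\<alpha>2 n..\<beta>2 n}" "cis ` {\<alpha>3 n..\<beta>3 n}" "cis ` {\<alpha>4 n..\<beta>4 n}"])
    fix u v assume "u \<in> cis ` {\<alpha>1 n..\<beta>1 n}" "v \<in> cis ` {\<alpha>3 n..\<beta>3 n}"
    then obtain s t where st: "u = cis s" "v = cis t" "\<alpha>1 n \<le> s" "s \<le> \<beta>1 n" "\<alpha>3 n \<le> t" "t \<le> \<beta>3 n" by auto
    then show "side u v (cis b') < 0 \<and> side u v (cis c') < 0 \<and> side u v (cis a') > 0 \<and> side u v (cis d') > 0"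
      using o le side_cis_sgn[of a' s t] by auto
  next
    fix u v assume "u \<in> cis ` {\<alpha>2 n..\<beta>2 n}" "v \<in> cis ` {\<alpha>4 n..\<beta>4 n}"
    then obtain s t where st: "u = cis s" "v = cis t" "\<alpha>2 n \<le> s" "s \<le> \<beta>2 n" "\<alpha>4 n \<le> t" "t \<le> \<beta>4 n" by auto
    then show "side u v (cis c') < 0 \<and> side u v (cis d') < 0 \<and> side u v (cis a') > 0 \<and> side u v (cis b') > 0"
      using o le side_cis_sgn[of a' s t] by auto
  qed (use o le cp m 13(7) 24(7) in auto)
qed

text \<open>A deck transformation makes both diagonals of the corner quadrilateral long. If chords
  of both boxes became short, two sides of the quadrilateral meeting at a corner would be short as
  well, contradicting the triangle inequality for a diagonal.\<close>

lemma box_constant_finite: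
  assumes "closed_hyperbolic_surface \<Gamma>" "geodesic_current \<Gamma> \<mu>"
  shows "box_constant \<mu> < \<infinity>"
proof -
  interpret closed_hyperbolic_surface \<Gamma> by fact
  interpret geodesic_current \<Gamma> \<mu> by fact
  obtain r where r: "r < 1" "\<And>p. p \<in> hyp_plane \<Longrightarrow> \<exists>g\<in>\<Gamma>. norm (g p) \<le> r"
    using deck_into_compact by blast
  \<comment> \<open>The threshold \<open>1 - r\<close> is half the lower bound for the diagonals, so
    two sides below it cannot span a diagonal.\<close>
  obtain U where U: "U \<in> sets \<mu>" "emeasure \<mu> U < \<infinity>" "long_chords (1 - r) \<subseteq> U"
    using long_chords_finite[of "1 - r"] r(1) by auto
  have "min (emeasure \<mu> B) (emeasure \<mu> B') \<le> emeasure \<mu> U" if opp: "(B, B') \<in> opposite_boxes" for B B'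
  proof (rule dense_le)
    fix m assume "m < min (emeasure \<mu> B) (emeasure \<mu> B')"
    then obtain a b c d C1 C2 C3 C4 where abcd: "a < b" "b < c" "c < d" "d < a + 2 * pi"
      and C: "C1 \<subseteq> sphere 0 1" "C2 \<subseteq> sphere 0 1" "C3 \<subseteq> sphere 0 1" "C4 \<subseteq> sphere 0 1"
      and C13: "\<And>u v. u \<in> C1 \<Longrightarrow> v \<in> C3 \<Longrightarrow> side u v (cis b) < 0 \<and> side u v (cis c) < 0 \<and> side u v (cis a) > 0 \<and> side u v (cis d) > 0"
      and C24: "\<And>u v. u \<in> C2 \<Longrightarrow> v \<in> C4 \<Longrightarrow> side u v (cis c) < 0 \<and> side u v (cis d) < 0 \<and> side u v (cis a) > 0 \<and> side u v (cis b) > 0"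
      and m: "box C1 C3 \<in> sets \<mu>" "box C2 C4 \<in> sets \<mu>" "m < emeasure \<mu> (box C1 C3)" "m < emeasure \<mu> (box C2 C4)"
      by (rule opposite_boxes_refine[OF assms(2) opp]) blast
    obtain p where p: "norm p < 1" "p \<in> closed_segment (cis a) (cis c)" "p \<in> closed_segment (cis b) (cis d)"
      using chords_cross[OF abcd] by blast
    obtain g where g: "g \<in> \<Gamma>" "norm (g p) \<le> r" using r(2) p(1) by auto
    define G where "G t = g (cis t)" for t
    have G: "G t \<in> sphere 0 1" for t unfolding G_def by (rule deck_boundary[OF g(1)]) simp
    have sgn: "sgn (side (g u) (g v) (G t)) = sgn (side u v (cis t))" if "u \<in> sphere 0 1" "v \<in> sphere 0 1" for u v t
      unfolding G_def by (rule deck_side_sgn[OF g(1) that]) simp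
    \<comment> \<open>The transformed diagonals pass through \<open>g p\<close>, which has norm at
      most \<open>r\<close>.\<close>
    have far: "2 * (1 - r) \<le> dist (G s) (G t)" if "p \<in> closed_segment (cis s) (cis t)" "cis s \<noteq> cis t" for s t
    proof (rule chord_length_ge[OF G G _ g(2)])
      have "side (cis s) (cis t) p = 0" using that side_eq_0_iff_segment[of "cis s" "cis t" p] p(1) by simp
      then have "side (G s) (G t) (g p) = 0"
        using deck_side_sgn[OF g(1), of "cis s" "cis t" p] p(1) by (simp add: G_def sgn_0_0)
      moreover have "G s \<noteq> G t" using deck_inv[OF g(1)] that(2) unfolding G_def by metis
      moreover have "norm (g p) < 1" using g(2) r(1) by simp
      ultimately show "g p \<in> closed_segment (G s) (G t)" using side_eq_0_iff_segment[OF G G] by simp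
    qed
    have "cis a \<noteq> cis c" "cis b \<noteq> cis d" using cis_inj[of a c] cis_inj[of b d] abcd by auto
    with far p have far: "2 * (1 - r) \<le> dist (G a) (G c)" "2 * (1 - r) \<le> dist (G b) (G d)" by auto
    \<comment> \<open>Once all transformed chords of a box are long, invariance bounds its measure
      by that of \<open>U\<close>, which does not depend on the box.\<close>
    have long: "m \<le> emeasure \<mu> U"
      if K: "box J J' \<in> sets \<mu>" "m < emeasure \<mu> (box J J')" and
        l: "\<And>u v. u \<in> J \<Longrightarrow> v \<in> J' \<Longrightarrow> u \<in> sphere 0 1 \<and> v \<in> sphere 0 1 \<and> 1 - r \<le> dist (g u) (g v)" for J J'
    proof -
      have "map_uprod g ` box J J' \<subseteq> long_chords (1 - r)"
      proof
        fix \<gamma> assume "\<gamma> \<in> map_uprod g ` box J J'"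
        then obtain u v where uv: "u \<in> J" "v \<in> J'" "\<gamma> = Upair (g u) (g v)" by (auto simp: box_def)
        then show "\<gamma> \<in> long_chords (1 - r)"
          using l[OF uv(1,2)] deck_boundary[OF g(1)] unfolding long_chords_def by blast
      qed
      then have "map_uprod g ` box J J' \<subseteq> U" using U(3) by (rule subset_trans)
      then have "emeasure \<mu> (map_uprod g ` box J J') \<le> emeasure \<mu> U" using U(1) by (rule emeasure_mono)
      then show ?thesis using invariant[OF g(1) K(1)] K(2) by simp
    qed
    show "m \<le> emeasure \<mu> U"
    proof (rule ccontr)
      assume "\<not> m \<le> emeasure \<mu> U"
      with long[OF m(1,3)] long[OF m(2,4)] C obtain u v u' v' where
        u: "u \<in> C1" "v \<in> C3" "dist (g u) (g v) < 1 - r" and u': "u' \<in> C2" "v' \<in> C4" "dist (g u') (g v') < 1 - r"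
        by (metis not_less subsetD)
      have sph: "u \<in> sphere 0 1" "v \<in> sphere 0 1" "u' \<in> sphere 0 1" "v' \<in> sphere 0 1" using C u u' by auto
      note sg = sgn[OF sph(1,2)] sgn[OF sph(3,4)]
      have s1: "side (g u) (g v) (G b) < 0" "side (g u) (g v) (G c) < 0" "0 < side (g u) (g v) (G a)" "0 < side (g u) (g v) (G d)"
        using C13[OF u(1,2)] sg(1) by (metis sgn_less sgn_greater)+
      have s2: "side (g u') (g v') (G c) < 0" "side (g u') (g v') (G d) < 0" "0 < side (g u') (g v') (G a)" "0 < side (g u') (g v') (G b)"
        using C24[OF u'(1,2)] sg(2) by (metis sgn_less sgn_greater)+
      \<comment> \<open>A short chord separating two corners from the other two forces one of these
        pairs to be close together.\<close>
      have "dist (G b) (G c) < 1 - r \<or> dist (G a) (G d) < 1 - r"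
        using separating_chord_length[OF deck_boundary[OF g(1) sph(1)] deck_boundary[OF g(1) sph(2)] G G G G s1] u(3) by auto
      moreover have "dist (G c) (G d) < 1 - r \<or> dist (G a) (G b) < 1 - r"
        using separating_chord_length[OF deck_boundary[OF g(1) sph(3)] deck_boundary[OF g(1) sph(4)] G G G G s2] u'(3) by auto
      ultimately show False
        using far dist_triangle[of "G a" "G c" "G b"] dist_triangle[of "G a" "G c" "G d"]
          dist_triangle[of "G b" "G d" "G a"] dist_triangle[of "G b" "G d" "G c"]
        by (auto simp: dist_commute)
    qed
  qed
  then have "box_constant \<mu> \<le> emeasure \<mu> U" unfolding box_constant_def by (auto intro!: SUP_least)
  then show ?thesis using U(2) by (rule order_le_less_trans)
qed

section \<open>The upper bound in the four-point condition\<close>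

text \<open>Weak separation: one pair lies strictly on one side, while points of the other may lie
  on the geodesic. The disjunction makes it independent of the chosen orientation.\<close>

definition separates :: "complex uprod \<Rightarrow> complex \<Rightarrow> complex \<Rightarrow> complex \<Rightarrow> complex \<Rightarrow> bool" where
  "separates \<gamma> x y z w \<longleftrightarrow> max (side_sign \<gamma> x) (side_sign \<gamma> y) < min (side_sign \<gamma> z) (side_sign \<gamma> w) \<or>
     max (side_sign \<gamma> z) (side_sign \<gamma> w) < min (side_sign \<gamma> x) (side_sign \<gamma> y)"

lemma separatesE:
  assumes "separates \<gamma> x y z w" "\<gamma> \<in> geodesics"
  obtains u v where "\<gamma> = Upair u v" "u \<in> hyp_boundary" "v \<in> hyp_boundary"
    "max (sgn (side u v x)) (sgn (side u v y)) < min (sgn (side u v z)) (sgn (side u v w))"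
proof -
  define u v where "u = fst (orientation \<gamma>)" and "v = snd (orientation \<gamma>)"
  have \<gamma>: "\<gamma> = Upair u v" using Upair_orientation[of \<gamma>] by (simp add: u_def v_def)
  then have uv: "u \<in> hyp_boundary" "v \<in> hyp_boundary" using assms(2) Upair_in_geodesics by auto
  have s: "side_sign \<gamma> p = sgn (side u v p)" "- side_sign \<gamma> p = sgn (side v u p)" for p
    unfolding side_sign_def u_def v_def by (simp_all add: side_swap[of "snd _" "fst _"] sgn_minus)
  from assms(1) show ?thesis unfolding separates_def
  proof
    assume "max (side_sign \<gamma> x) (side_sign \<gamma> y) < min (side_sign \<gamma> z) (side_sign \<gamma> w)"
    then show ?thesis using that[OF \<gamma> uv] by (simp add: s(1))
  next
    assume "max (side_sign \<gamma> z) (side_sign \<gamma> w) < min (side_sign \<gamma> x) (side_sign \<gamma> y)"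
    then have "max (- side_sign \<gamma> x) (- side_sign \<gamma> y) < min (- side_sign \<gamma> z) (- side_sign \<gamma> w)" by auto
    moreover have "\<gamma> = Upair v u" using \<gamma> by simp
    ultimately show ?thesis using that[OF _ uv(2,1)] unfolding s(2) by blast
  qed
qed

text \<open>Prolonging the diagonals \<open>xz\<close> and \<open>yw\<close> to infinity turns weak
  separation of the points into strict separation of the four ends. The two kinds then lie in
  opposite boxes, one of which has measure at most \<open>box_constant \<mu>\<close>.\<close>

lemma separated_pairs_box:
  assumes "geodesic_current \<Gamma> \<mu>" "x \<in> hyp_plane" "y \<in> hyp_plane" "z \<in> hyp_plane" "w \<in> hyp_plane"
  obtains B where "B \<in> sets \<mu>" "emeasure \<mu> B \<le> box_constant \<mu>"
    "(\<forall>\<gamma>\<in>geodesics. separates \<gamma> x y z w \<longrightarrow> \<gamma> \<in> B) \<or> (\<forall>\<gamma>\<in>geodesics. separates \<gamma> x w y z \<longrightarrow> \<gamma> \<in> B)"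
proof (cases "(\<exists>\<gamma>\<in>geodesics. separates \<gamma> x y z w) \<and> (\<exists>\<gamma>\<in>geodesics. separates \<gamma> x w y z)")
  \<comment> \<open>If one kind of separation never occurs, the empty set covers it.\<close>
  case False
  then show ?thesis using that[of "{}"] by auto
next
  case True
  interpret geodesic_current \<Gamma> \<mu> by fact
  from True obtain \<gamma> \<gamma>' where \<gamma>: "\<gamma> \<in> geodesics" "separates \<gamma> x y z w" "\<gamma>' \<in> geodesics" "separates \<gamma>' x w y z" by blast
  then have "x \<noteq> z" "y \<noteq> w" by (auto simp: separates_def)
  note n = assms(2-5)[unfolded mem_ball_0]
  obtain t1 where t1: "t1 > 0" "norm (x + t1 *\<^sub>R (x - z)) = 1" using ray_meets_circle n(1) \<open>x \<noteq> z\<close> by blast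
  obtain t2 where t2: "t2 > 0" "norm (y + t2 *\<^sub>R (y - w)) = 1" using ray_meets_circle n(2) \<open>y \<noteq> w\<close> by blast
  obtain t3 where t3: "t3 > 0" "norm (z + t3 *\<^sub>R (z - x)) = 1" using ray_meets_circle n(3) \<open>x \<noteq> z\<close> by metis
  obtain t4 where t4: "t4 > 0" "norm (w + t4 *\<^sub>R (w - y)) = 1" using ray_meets_circle n(4) \<open>y \<noteq> w\<close> by metis
  \<comment> \<open>The ends at infinity of the lines \<open>xz\<close> and \<open>yw\<close>, each
    beyond the point whose letter it carries.\<close>
  define x' y' z' w' where "x' = x + t1 *\<^sub>R (x - z)" and "y' = y + t2 *\<^sub>R (y - w)"
    and "z' = z + t3 *\<^sub>R (z - x)" and "w' = w + t4 *\<^sub>R (w - y)"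
  have sph: "x' \<in> sphere 0 1" "y' \<in> sphere 0 1" "z' \<in> sphere 0 1" "w' \<in> sphere 0 1"
    using t1 t2 t3 t4 by (auto simp: x'_def y'_def z'_def w'_def)
  \<comment> \<open>The side is affine and not constant along the line, so beyond a point where it
    is at most zero it becomes strictly negative, and symmetrically at the other end.\<close>
  have ray: "side u v (p + t *\<^sub>R (p - q)) < 0" "0 < side u v (q + t *\<^sub>R (q - p))"
    if "sgn (side u v p) < sgn (side u v q)" "t > 0" for u v p q t
  proof -
    have pq: "side u v p \<le> 0" "0 \<le> side u v q" "side u v p < side u v q"
      using that(1) by (auto simp: sgn_if split: if_splits)
    then have "t * side u v p < t * side u v q" using that(2) by simp
    then show "side u v (p + t *\<^sub>R (p - q)) < 0" "0 < side u v (q + t *\<^sub>R (q - p))"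
      unfolding side_ray using pq by (auto simp: algebra_simps)
  qed
  have V1: "\<gamma> \<in> separating_pairs x' y' z' w'" if \<gamma>: "\<gamma> \<in> geodesics" "separates \<gamma> x y z w" for \<gamma>
  proof -
    obtain u v where "\<gamma> = Upair u v" "u \<in> hyp_boundary" "v \<in> hyp_boundary"
      and s: "max (sgn (side u v x)) (sgn (side u v y)) < min (sgn (side u v z)) (sgn (side u v w))"
      using separatesE[OF \<gamma>(2,1)] by blast
    moreover have "side u v x' < 0" "side u v y' < 0" "0 < side u v z'" "0 < side u v w'"
      unfolding x'_def y'_def z'_def w'_def using ray t1 t2 t3 t4 s by auto
    ultimately show ?thesis unfolding separating_pairs_def by blast
  qed
  have V2: "\<gamma> \<in> separating_pairs x' w' y' z'" if \<gamma>: "\<gamma> \<in> geodesics" "separates \<gamma> x w y z" for \<gamma>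
  proof -
    obtain u v where "\<gamma> = Upair u v" "u \<in> hyp_boundary" "v \<in> hyp_boundary"
      and s: "max (sgn (side u v x)) (sgn (side u v w)) < min (sgn (side u v y)) (sgn (side u v z))"
      using separatesE[OF \<gamma>(2,1)] by blast
    moreover have "side u v x' < 0" "side u v w' < 0" "0 < side u v y'" "0 < side u v z'"
      unfolding x'_def y'_def z'_def w'_def using ray t1 t2 t3 t4 s by auto
    ultimately show ?thesis unfolding separating_pairs_def by blast
  qed
  have "separating_pairs x' y' z' w' \<noteq> {}" "separating_pairs x' w' y' z' \<noteq> {}" using \<gamma> V1 V2 by auto
  then obtain B B' where B: "(B, B') \<in> opposite_boxes"
    "separating_pairs x' y' z' w' \<subseteq> B \<and> separating_pairs x' w' y' z' \<subseteq> B' \<or>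
     separating_pairs x' y' z' w' \<subseteq> B' \<and> separating_pairs x' w' y' z' \<subseteq> B"
    using separating_pairs_opposite_boxes[OF sph] by blast
  have "min (emeasure \<mu> B) (emeasure \<mu> B') \<le> box_constant \<mu>"
    unfolding box_constant_def by (rule SUP_upper2[OF B(1)]) simp
  then have "emeasure \<mu> B \<le> box_constant \<mu> \<or> emeasure \<mu> B' \<le> box_constant \<mu>" by (auto simp: min_le_iff_disj)
  then show ?thesis
  proof
    assume "emeasure \<mu> B \<le> box_constant \<mu>"
    then show ?thesis using that[of B] opposite_boxes_measurable(1)[OF B(1)] B(2) V1 V2 by blast
  next
    assume "emeasure \<mu> B' \<le> box_constant \<mu>"
    then show ?thesis using that[of B'] opposite_boxes_measurable(2)[OF B(1)] B(2) V1 V2 by blast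
  qed
qed

text \<open>Either of the two other pairings can be compared with the first, at the cost of one kind
  of separating geodesics. The maximum appears because it is not known which kind lies in the small
  box.\<close>

lemma four_point_upper:
  assumes "closed_hyperbolic_surface \<Gamma>" "geodesic_current \<Gamma> \<mu>"
    and "x \<in> hyp_plane" "y \<in> hyp_plane" "z \<in> hyp_plane" "w \<in> hyp_plane"
  defines "d \<equiv> current_dist \<mu>"
  shows "d x y + d z w \<le> max (d x z + d y w) (d x w + d y z) + 2 * enn2real (box_constant \<mu>)"
proof -
  interpret geodesic_current \<Gamma> \<mu> by fact
  obtain B where B: "B \<in> sets \<mu>" "emeasure \<mu> B \<le> box_constant \<mu>"
    "(\<forall>\<gamma>\<in>geodesics. separates \<gamma> x z y w \<longrightarrow> \<gamma> \<in> B) \<or> (\<forall>\<gamma>\<in>geodesics. separates \<gamma> x w z y \<longrightarrow> \<gamma> \<in> B)"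
    using separated_pairs_box[OF assms(2,3,5,4,6)] by blast
  have fin: "emeasure \<mu> B < \<infinity>" using B(2) box_constant_finite[OF assms(1,2)] by (rule order_le_less_trans)
  have le: "measure \<mu> B \<le> enn2real (box_constant \<mu>)"
    unfolding measure_def using B(2) box_constant_finite[OF assms(1,2)] by (intro enn2real_mono) auto
  \<comment> \<open>For numbers on a line the first pairing exceeds the second only if
    \<open>{p, r}\<close> and \<open>{q, s}\<close> are separated, and for signs the halved excess
    is at most 2.\<close>
  have arith: "\<bar>p - q\<bar> / 2 + \<bar>r - s\<bar> / 2 \<le> \<bar>p - r\<bar> / 2 + \<bar>q - s\<bar> / 2 + 2 * (i :: real)"
    if "{p, q, r, s} \<subseteq> {-1, 0, 1}" "i \<ge> 0" "max p r < min q s \<or> max q s < min p r \<Longrightarrow> i = 1" for p q r s i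
    using that by auto
  have sv: "{side_sign \<gamma> p, side_sign \<gamma> q, side_sign \<gamma> r, side_sign \<gamma> s} \<subseteq> {-1, 0, 1}" for \<gamma> p q r s
    using side_sign_values by blast
  from B(3) show ?thesis
  proof
    assume *: "\<forall>\<gamma>\<in>geodesics. separates \<gamma> x z y w \<longrightarrow> \<gamma> \<in> B"
    have "d x y + d z w \<le> d x z + d y w + 2 * measure \<mu> B"
      unfolding d_def
      by (intro current_dist_mono assms B fin arith sv) (use * in \<open>auto simp: separates_def\<close>)
    then show ?thesis using le by linarith
  next
    assume *: "\<forall>\<gamma>\<in>geodesics. separates \<gamma> x w z y \<longrightarrow> \<gamma> \<in> B"
    have "d x y + d w z \<le> d x w + d y z + 2 * measure \<mu> B"
      unfolding d_def
      by (intro current_dist_mono assms B fin arith sv) (use * in \<open>auto simp: separates_def max.commute min.commute\<close>)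
    then show ?thesis using le current_dist_commute[of \<mu> w z] unfolding d_def by linarith
  qed
qed

section \<open>The lower bound in the four-point condition\<close>

text \<open>Corners taken in the gaps and pulled slightly into the disc form a convex quadrilateral.
  Its diagonal sum dominates both sums of opposite sides pointwise, with an excess of 2 on each
  chord of one of the two boxes.\<close>

lemma four_point_lower:
  assumes "geodesic_current \<Gamma> \<mu>" "(B, B') \<in> opposite_boxes" "ennreal m < min (emeasure \<mu> B) (emeasure \<mu> B')"
  defines "d \<equiv> current_dist \<mu>"
  obtains x y z w where "x \<in> hyp_plane" "y \<in> hyp_plane" "z \<in> hyp_plane" "w \<in> hyp_plane"
    "d x y + d z w + 2 * m \<le> d x z + d y w" "d x w + d y z + 2 * m \<le> d x z + d y w"
proof -
  interpret geodesic_current \<Gamma> \<mu> by fact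
  obtain a b c e C1 C2 C3 C4 where abc: "a < b" "b < c" "c < e" "e < a + 2 * pi"
    and C: "compact C1" "compact C2" "compact C3" "compact C4"
      "C1 \<subseteq> sphere 0 1" "C2 \<subseteq> sphere 0 1" "C3 \<subseteq> sphere 0 1" "C4 \<subseteq> sphere 0 1"
    and C13: "\<And>u v. u \<in> C1 \<Longrightarrow> v \<in> C3 \<Longrightarrow> side u v (cis b) < 0 \<and> side u v (cis c) < 0 \<and> side u v (cis a) > 0 \<and> side u v (cis e) > 0"
    and C24: "\<And>u v. u \<in> C2 \<Longrightarrow> v \<in> C4 \<Longrightarrow> side u v (cis c) < 0 \<and> side u v (cis e) < 0 \<and> side u v (cis a) > 0 \<and> side u v (cis b) > 0"
    and m: "box C1 C3 \<in> sets \<mu>" "box C2 C4 \<in> sets \<mu>" "ennreal m < emeasure \<mu> (box C1 C3)" "ennreal m < emeasure \<mu> (box C2 C4)"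
    by (rule opposite_boxes_refine[OF assms(1-3)]) blast
  have cc: "compact (C1 \<times> C3)" "compact (C2 \<times> C4)" "C1 \<times> C3 \<subseteq> sphere 0 1 \<times> sphere 0 1" "C2 \<times> C4 \<subseteq> sphere 0 1 \<times> sphere 0 1"
    using C by (auto intro: compact_Times)
  have "\<forall>\<^sub>F r in at_left 1. \<forall>(u, v)\<in>C1 \<times> C3. sgn (side u v (r *\<^sub>R cis t)) = sgn (side u v (cis t))"
    if "t \<in> {a, b, c, e}" for t
    by (rule side_radial_sgn[OF cc(1,3)]) (use that C13 in fastforce)+
  moreover have "\<forall>\<^sub>F r in at_left 1. \<forall>(u, v)\<in>C2 \<times> C4. sgn (side u v (r *\<^sub>R cis t)) = sgn (side u v (cis t))"
    if "t \<in> {a, b, c, e}" for t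
    by (rule side_radial_sgn[OF cc(2,4)]) (use that C24 in fastforce)+
  \<comment> \<open>There are only four corners and two compact families, so all sign conditions
    hold together for \<open>r\<close> near 1.\<close>
  ultimately have "\<forall>\<^sub>F r in at_left 1. \<forall>t\<in>{a, b, c, e}. \<forall>(u, v)\<in>C1 \<times> C3 \<union> C2 \<times> C4.
      sgn (side u v (r *\<^sub>R cis t)) = sgn (side u v (cis t))"
    by (simp add: eventually_conj_iff ball_Un)
  moreover have "\<forall>\<^sub>F r in at_left 1. r \<in> {0<..<1::real}" by (intro eventually_at_left_real) simp
  ultimately have ev: "\<forall>\<^sub>F r in at_left (1::real). r \<in> {0<..<1} \<and> (\<forall>t\<in>{a, b, c, e}. \<forall>(u, v)\<in>C1 \<times> C3 \<union> C2 \<times> C4.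
      sgn (side u v (r *\<^sub>R cis t)) = sgn (side u v (cis t)))"
    by (rule eventually_conj[rotated])
  obtain r :: real where r': "r \<in> {0<..<1} \<and> (\<forall>t\<in>{a, b, c, e}. \<forall>(u, v)\<in>C1 \<times> C3 \<union> C2 \<times> C4.
      sgn (side u v (r *\<^sub>R cis t)) = sgn (side u v (cis t)))"
    using eventually_happens'[OF trivial_limit_at_left_real ev] ..
  then have r: "0 < r" "r < 1" by auto
  have sg: "\<And>t u v. t \<in> {a, b, c, e} \<Longrightarrow> (u, v) \<in> C1 \<times> C3 \<union> C2 \<times> C4 \<Longrightarrow> sgn (side u v (r *\<^sub>R cis t)) = sgn (side u v (cis t))"
    using r' by blast
  define x y z w where "x = r *\<^sub>R cis a" and "y = r *\<^sub>R cis b" and "z = r *\<^sub>R cis c" and "w = r *\<^sub>R cis e"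
  have pl: "x \<in> hyp_plane" "y \<in> hyp_plane" "z \<in> hyp_plane" "w \<in> hyp_plane"
    using r by (auto simp: x_def y_def z_def w_def)
  \<comment> \<open>The crossing point of the boundary chords, scaled by \<open>r\<close>, is a
    common point of the diagonals.\<close>
  obtain p where p: "p \<in> closed_segment x z" "p \<in> closed_segment y w"
  proof -
    obtain q where q: "q \<in> closed_segment (cis a) (cis c)" "q \<in> closed_segment (cis b) (cis e)"
      using chords_cross[OF abc] by blast
    then have "r *\<^sub>R q \<in> (*\<^sub>R) r ` closed_segment (cis a) (cis c)" "r *\<^sub>R q \<in> (*\<^sub>R) r ` closed_segment (cis b) (cis e)"
      by auto
    then show ?thesis using that[of "r *\<^sub>R q"] unfolding x_def y_def z_def w_def
      by (simp only: closed_segment_linear_image[of "(*\<^sub>R) r"] linear_scaleR)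
  qed
  \<comment> \<open>The side at the crossing point lies between its values at \<open>x\<close> and
    \<open>z\<close> and also between those at \<open>y\<close> and \<open>w\<close>, so these two
    ranges cannot be disjoint.\<close>
  have nosep: "\<not> separates \<gamma> x z y w" if \<gamma>: "\<gamma> \<in> geodesics" for \<gamma>
  proof
    assume "separates \<gamma> x z y w"
    then obtain u v where "\<gamma> = Upair u v" "u \<in> hyp_boundary" "v \<in> hyp_boundary"
      and s: "max (sgn (side u v x)) (sgn (side u v z)) < min (sgn (side u v y)) (sgn (side u v w))"
      using \<gamma> by (rule separatesE)
    have lt: "A < B" if "sgn A < sgn B" for A B :: real using that by (auto simp: sgn_if split: if_splits)
    have "side u v x < side u v y" "side u v x < side u v w" "side u v z < side u v y" "side u v z < side u v w"
      by (rule lt, use s in simp)+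
    then have mm: "max (side u v x) (side u v z) < min (side u v y) (side u v w)" by auto
    obtain s t where st: "0 \<le> s" "s \<le> 1" "0 \<le> t" "t \<le> 1" "p = (1 - s) *\<^sub>R x + s *\<^sub>R z" "p = (1 - t) *\<^sub>R y + t *\<^sub>R w"
      using p by (auto simp: in_segment)
    have "side u v p \<le> max (side u v x) (side u v z)"
      unfolding st(5) side_affine by (rule convex_bound_le) (use st in auto)
    moreover have "min (side u v y) (side u v w) \<le> side u v p"
    proof -
      have "(1 - t) * - side u v y + t * - side u v w \<le> - min (side u v y) (side u v w)"
        by (rule convex_bound_le) (use st in auto)
      then show ?thesis unfolding st(6) side_affine by simp
    qed
    ultimately show False using mm by simp
  qed
  have sv: "{side_sign \<gamma> p, side_sign \<gamma> q, side_sign \<gamma> r, side_sign \<gamma> s} \<subseteq> {-1, 0, 1}" for \<gamma> p q r s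
    using side_sign_values by blast
  \<comment> \<open>Here \<open>i\<close> is the indicator of a box: on its chords \<open>p\<close>,
    \<open>q\<close> face \<open>r\<close>, \<open>s\<close>, and the right-hand sum exceeds the
    left by exactly 2.\<close>
  have arith: "\<bar>p - q\<bar> / 2 + \<bar>r - s\<bar> / 2 \<le> \<bar>p - r\<bar> / 2 + \<bar>q - s\<bar> / 2 + (- 2) * (i :: real)"
    if "{p, q, r, s} \<subseteq> {-1, 0, 1}" "\<not> (max p r < min q s \<or> max q s < min p r)"
      "i = 0 \<or> i = 1 \<and> p = q \<and> r = - p \<and> s = - p \<and> p \<noteq> 0" for p q r s i
    using that(3)
  proof
    assume "i = 0"
    moreover have "\<bar>p - q\<bar> + \<bar>r - s\<bar> \<le> \<bar>p - r\<bar> + \<bar>q - s\<bar>"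
      using that(2) by (smt (verit))
    ultimately show ?thesis by simp
  next
    assume i: "i = 1 \<and> p = q \<and> r = - p \<and> s = - p \<and> p \<noteq> 0"
    then have "p = 1 \<or> p = - 1" using that(1) by auto
    then show ?thesis using i by auto
  qed
  have box_signs: "side_sign \<gamma> A = side_sign \<gamma> A' \<and> side_sign \<gamma> D = - side_sign \<gamma> A \<and> side_sign \<gamma> D' = - side_sign \<gamma> A \<and> side_sign \<gamma> A \<noteq> 0"
    if "\<gamma> \<in> box I J" "\<And>u v. u \<in> I \<Longrightarrow> v \<in> J \<Longrightarrow> side u v A < 0 \<and> side u v A' < 0 \<and> side u v D > 0 \<and> side u v D' > 0"
    for \<gamma> I J A A' D D'
  proof -
    obtain u v where uv: "\<gamma> = Upair u v" "u \<in> I" "v \<in> J" using \<open>\<gamma> \<in> box I J\<close> unfolding box_def by blast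
    note s = that(2)[OF uv(2,3)]
    show ?thesis unfolding uv(1) by (rule side_sign_Upair[of u v]) (simp_all add: s)
  qed
  have side13: "side u v y < 0 \<and> side u v z < 0 \<and> side u v x > 0 \<and> side u v w > 0" if "u \<in> C1" "v \<in> C3" for u v
    using C13[OF that] sg[of a u v] sg[of b u v] sg[of c u v] sg[of e u v] that unfolding x_def y_def z_def w_def
    by (auto simp: sgn_if split: if_splits)
  have side24: "side u v z < 0 \<and> side u v w < 0 \<and> side u v x > 0 \<and> side u v y > 0" if "u \<in> C2" "v \<in> C4" for u v
    using C24[OF that] sg[of a u v] sg[of b u v] sg[of c u v] sg[of e u v] that unfolding x_def y_def z_def w_def
    by (auto simp: sgn_if split: if_splits)
  \<comment> \<open>Finiteness must come first, because \<open>measure\<close> is 0 on a set of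
    infinite measure. It holds since every chord of \<open>K\<close> separates \<open>x\<close> from
    \<open>z\<close>.\<close>
  have fin: "emeasure \<mu> K < \<infinity> \<and> m \<le> measure \<mu> K"
    if K: "K \<in> sets \<mu>" "\<And>\<gamma>. \<gamma> \<in> K \<Longrightarrow> side_sign \<gamma> x * side_sign \<gamma> z < 0" "ennreal m < emeasure \<mu> K" for K
  proof -
    have "K \<subseteq> transverse_geodesics (hyp_segment x z - {z})"
      unfolding transverse_half_open[OF pl(1,3)] using K sets.sets_into_space space_current by blast
    then have "emeasure \<mu> K < \<infinity>"
      using transverse_measurable[OF pl(1,3)] emeasure_mono order_le_less_trans by blast
    moreover have "m \<le> measure \<mu> K"
    proof (rule ccontr)
      assume "\<not> m \<le> measure \<mu> K"
      then have "ennreal (measure \<mu> K) \<le> ennreal m" by (intro ennreal_leI) simp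
      then show False using K(3) calculation emeasure_eq_ennreal_measure[of \<mu> K] by auto
    qed
    ultimately show ?thesis ..
  qed
  have signs13: "side_sign \<gamma> y = side_sign \<gamma> z \<and> side_sign \<gamma> x = - side_sign \<gamma> y \<and>
      side_sign \<gamma> w = - side_sign \<gamma> y \<and> side_sign \<gamma> y \<noteq> 0" if "\<gamma> \<in> box C1 C3" for \<gamma>
    using that side13 by (rule box_signs)
  have signs24: "side_sign \<gamma> z = side_sign \<gamma> w \<and> side_sign \<gamma> x = - side_sign \<gamma> z \<and>
      side_sign \<gamma> y = - side_sign \<gamma> z \<and> side_sign \<gamma> z \<noteq> 0" if "\<gamma> \<in> box C2 C4" for \<gamma>
    using that side24 by (rule box_signs)
  have prod: "side_sign \<gamma> x * side_sign \<gamma> z < 0" if "\<gamma> \<in> box C1 C3 \<union> box C2 C4" for \<gamma>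
    using signs13[of \<gamma>] signs24[of \<gamma>] that by (auto simp: zero_less_mult_iff)
  have K1: "emeasure \<mu> (box C1 C3) < \<infinity> \<and> m \<le> measure \<mu> (box C1 C3)"
    by (rule fin[OF m(1) _ m(3)]) (use prod in blast)
  have K2: "emeasure \<mu> (box C2 C4) < \<infinity> \<and> m \<le> measure \<mu> (box C2 C4)"
    by (rule fin[OF m(2) _ m(4)]) (use prod in blast)
  have sep13: "\<not> (max (side_sign \<gamma> x) (side_sign \<gamma> z) < min (side_sign \<gamma> w) (side_sign \<gamma> y) \<or>
       max (side_sign \<gamma> w) (side_sign \<gamma> y) < min (side_sign \<gamma> x) (side_sign \<gamma> z))"
    and sep24: "\<not> (max (side_sign \<gamma> x) (side_sign \<gamma> z) < min (side_sign \<gamma> y) (side_sign \<gamma> w) \<or>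
       max (side_sign \<gamma> y) (side_sign \<gamma> w) < min (side_sign \<gamma> x) (side_sign \<gamma> z))" if "\<gamma> \<in> geodesics" for \<gamma>
    using nosep[OF that] unfolding separates_def by (simp_all add: max.commute min.commute)
  have ind13: "indicator (box C1 C3) \<gamma> = (0::real) \<or> indicator (box C1 C3) \<gamma> = (1::real) \<and> side_sign \<gamma> x = side_sign \<gamma> w \<and>
      side_sign \<gamma> z = - side_sign \<gamma> x \<and> side_sign \<gamma> y = - side_sign \<gamma> x \<and> side_sign \<gamma> x \<noteq> 0" for \<gamma>
    using signs13[of \<gamma>] by (cases "\<gamma> \<in> box C1 C3") auto
  have ind24: "indicator (box C2 C4) \<gamma> = (0::real) \<or> indicator (box C2 C4) \<gamma> = (1::real) \<and> side_sign \<gamma> x = side_sign \<gamma> y \<and>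
      side_sign \<gamma> z = - side_sign \<gamma> x \<and> side_sign \<gamma> w = - side_sign \<gamma> x \<and> side_sign \<gamma> x \<noteq> 0" for \<gamma>
    using signs24[of \<gamma>] by (cases "\<gamma> \<in> box C2 C4") auto
  have "d x w + d z y \<le> d x z + d w y + (- 2) * measure \<mu> (box C1 C3)"
    unfolding d_def using pl m K1
    by (intro current_dist_mono arith sv sep13 ind13) auto
  moreover have "d x y + d z w \<le> d x z + d y w + (- 2) * measure \<mu> (box C2 C4)"
    unfolding d_def using pl m K2
    by (intro current_dist_mono arith sv sep24 ind24) auto
  moreover have "d z y = d y z" "d w y = d y w" unfolding d_def by (rule current_dist_commute)+
  ultimately have "d x y + d z w + 2 * m \<le> d x z + d y w" "d x w + d y z + 2 * m \<le> d x z + d y w"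
    using K1 K2 by linarith+
  then show ?thesis by (rule that[OF pl])
qed

text \<open>For the largest entry the inequality is the gap condition itself. That condition forces
  \<open>\<delta>\<close> to be nonnegative, which makes the other two automatic.\<close>

lemma sort3_gap:
  fixes A B C \<delta> :: real
  shows "(let S = sort [A, B, C] in S ! 2 - S ! 1 \<le> 2 * \<delta>) \<longleftrightarrow>
    A \<le> max B C + 2 * \<delta> \<and> B \<le> max A C + 2 * \<delta> \<and> C \<le> max A B + 2 * \<delta>"
  by (auto simp: Let_def)

section \<open>The dual space\<close>

context geodesic_current
begin

lemma equiv_dual_rel: "equiv hyp_plane (dual_rel \<mu>)"
proof (intro equivI refl_onI symI transI)
  fix x y z assume "(x, y) \<in> dual_rel \<mu>" "(y, z) \<in> dual_rel \<mu>"
  then show "(x, z) \<in> dual_rel \<mu>"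
    using current_dist_triangle[of x y z] current_dist_nonneg[of \<mu> x z] by (auto simp: dual_rel_def)
qed (auto simp: dual_rel_def current_dist_self current_dist_commute)

lemma dual_space_representative:
  assumes "P \<in> dual_space \<mu>"
  shows "(SOME x. x \<in> P) \<in> P" "(SOME x. x \<in> P) \<in> hyp_plane"
proof -
  have "P \<noteq> {}" "P \<subseteq> hyp_plane"
    using assms in_quotient_imp_non_empty[OF equiv_dual_rel] in_quotient_imp_subset[OF equiv_dual_rel]
    unfolding dual_space_def by blast+
  then show "(SOME x. x \<in> P) \<in> P" "(SOME x. x \<in> P) \<in> hyp_plane"
    using some_in_eq by blast+
qed

text \<open>Replacing a point by another at distance 0 changes no distance, by the triangle
  inequality in both directions.\<close>

lemma dual_dist_classes:
  assumes "x \<in> hyp_plane" "y \<in> hyp_plane"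
  shows "dual_dist \<mu> (dual_rel \<mu> `` {x}) (dual_rel \<mu> `` {y}) = current_dist \<mu> x y"
proof -
  define x' y' where "x' = (SOME z. z \<in> dual_rel \<mu> `` {x})" and "y' = (SOME z. z \<in> dual_rel \<mu> `` {y})"
  have "x' \<in> dual_rel \<mu> `` {x}" "y' \<in> dual_rel \<mu> `` {y}"
    unfolding x'_def y'_def using assms by (intro dual_space_representative(1); simp add: dual_space_def quotientI)+
  then have *: "x' \<in> hyp_plane" "y' \<in> hyp_plane" "current_dist \<mu> x x' = 0" "current_dist \<mu> y y' = 0"
    by (auto simp: dual_rel_def)
  have "current_dist \<mu> x' y' = current_dist \<mu> x y"
    using current_dist_triangle[of x' x y'] current_dist_triangle[of x y y']
      current_dist_triangle[of x x' y] current_dist_triangle[of x' y' y]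
      current_dist_commute[of \<mu> x' x] current_dist_commute[of \<mu> y' y] assms * by linarith
  then show ?thesis by (simp add: dual_dist_def x'_def y'_def)
qed

lemma Metric_space_dual: "Metric_space (dual_space \<mu>) (dual_dist \<mu>)"
proof
  show "0 \<le> dual_dist \<mu> P Q" "dual_dist \<mu> P Q = dual_dist \<mu> Q P" for P Q
    by (simp_all add: dual_dist_def current_dist_nonneg current_dist_commute)
  show "dual_dist \<mu> P Q = 0 \<longleftrightarrow> P = Q" if P: "P \<in> dual_space \<mu>" and Q: "Q \<in> dual_space \<mu>" for P Q
  proof -
    have "P = Q \<longleftrightarrow> ((SOME x. x \<in> P), (SOME x. x \<in> Q)) \<in> dual_rel \<mu>"
      using quotient_eq_iff[OF equiv_dual_rel] dual_space_representative[OF P] dual_space_representative[OF Q] P Q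
      unfolding dual_space_def by blast
    then show ?thesis
      using dual_space_representative(2)[OF P] dual_space_representative(2)[OF Q]
      by (simp add: dual_rel_def dual_dist_def)
  qed
  show "dual_dist \<mu> P R \<le> dual_dist \<mu> P Q + dual_dist \<mu> Q R"
    if "P \<in> dual_space \<mu>" "Q \<in> dual_space \<mu>" "R \<in> dual_space \<mu>" for P Q R
    unfolding dual_dist_def using that by (intro current_dist_triangle dual_space_representative)
qed

end

section \<open>Hyperbolicity and optimality\<close>

lemma hyperbolic_space_dual:
  assumes "closed_hyperbolic_surface \<Gamma>" "geodesic_current \<Gamma> \<mu>"
  shows "hyperbolic_space (enn2real (box_constant \<mu>)) (dual_space \<mu>) (dual_dist \<mu>)"
proof -
  interpret geodesic_current \<Gamma> \<mu> by fact
  \<comment> \<open>The upper bound for each of the three ways of pairing the points.\<close>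
  have four: "current_dist \<mu> x y + current_dist \<mu> z w \<le>
      max (current_dist \<mu> x z + current_dist \<mu> y w) (current_dist \<mu> y z + current_dist \<mu> x w) + 2 * enn2real (box_constant \<mu>) \<and>
    current_dist \<mu> x z + current_dist \<mu> y w \<le>
      max (current_dist \<mu> x y + current_dist \<mu> z w) (current_dist \<mu> y z + current_dist \<mu> x w) + 2 * enn2real (box_constant \<mu>) \<and>
    current_dist \<mu> y z + current_dist \<mu> x w \<le>
      max (current_dist \<mu> x y + current_dist \<mu> z w) (current_dist \<mu> x z + current_dist \<mu> y w) + 2 * enn2real (box_constant \<mu>)"
    if "x \<in> hyp_plane" "y \<in> hyp_plane" "z \<in> hyp_plane" "w \<in> hyp_plane" for x y z w
    using four_point_upper[OF assms that] four_point_upper[OF assms that(1,3,2,4)] four_point_upper[OF assms that(1,4,2,3)]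
    by (simp add: current_dist_commute[of \<mu> z y] current_dist_commute[of \<mu> w y] current_dist_commute[of \<mu> w z] add.commute max.commute)
  show ?thesis
    unfolding hyperbolic_space_def sort3_gap
    using Metric_space_dual four[OF dual_space_representative(2) dual_space_representative(2)
        dual_space_representative(2) dual_space_representative(2)] unfolding dual_dist_def by blast
qed

text \<open>For any \<open>m\<close> below both measures of an opposite pair, some four points have
  defect at least \<open>2 * m\<close>, so \<open>m \<le> \<delta>\<close>; then take
  suprema.\<close>

lemma box_constant_le_hyperbolicity:
  assumes "geodesic_current \<Gamma> \<mu>" and hyp: "hyperbolic_space \<delta> (dual_space \<mu>) (dual_dist \<mu>)"
  shows "enn2real (box_constant \<mu>) \<le> \<delta>"
proof -
  interpret geodesic_current \<Gamma> \<mu> by fact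
  let ?d = "current_dist \<mu>"
  have four: "?d x z + ?d y w \<le> max (?d x y + ?d z w) (?d y z + ?d x w) + 2 * \<delta>"
    if "x \<in> hyp_plane" "y \<in> hyp_plane" "z \<in> hyp_plane" "w \<in> hyp_plane" for x y z w
  proof -
    have "dual_rel \<mu> `` {p} \<in> dual_space \<mu>" if "p \<in> hyp_plane" for p
      using that by (simp add: dual_space_def quotientI)
    note cl = this[OF that(1)] this[OF that(2)] this[OF that(3)] this[OF that(4)]
    show ?thesis
      using hyp[unfolded hyperbolic_space_def sort3_gap, THEN conjunct2, rule_format, OF cl]
      unfolding dual_dist_classes[OF that(1,2)] dual_dist_classes[OF that(1,3)] dual_dist_classes[OF that(1,4)]
        dual_dist_classes[OF that(2,3)] dual_dist_classes[OF that(2,4)] dual_dist_classes[OF that(3,4)] by blast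
  qed
  have "0 \<in> hyp_plane" by simp
  \<comment> \<open>Four equal points suffice. Without the sign, \<open>ennreal \<delta>\<close>
    would truncate to 0 and not represent \<open>\<delta>\<close>.\<close>
  then have "0 \<le> \<delta>" using four[of 0 0 0 0] current_dist_self by simp
  have "min (emeasure \<mu> B) (emeasure \<mu> B') \<le> ennreal \<delta>" if opp: "(B, B') \<in> opposite_boxes" for B B'
  proof (rule dense_le)
    fix m assume m: "m < min (emeasure \<mu> B) (emeasure \<mu> B')"
    then have "m < top" using order_less_le_trans top_greatest by blast
    then have m': "ennreal (enn2real m) = m" by simp
    obtain x y z w where "x \<in> hyp_plane" "y \<in> hyp_plane" "z \<in> hyp_plane" "w \<in> hyp_plane"
      and le: "?d x y + ?d z w + 2 * enn2real m \<le> ?d x z + ?d y w" "?d x w + ?d y z + 2 * enn2real m \<le> ?d x z + ?d y w"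
      by (rule four_point_lower[OF assms(1) opp, of "enn2real m"]) (use m m' in simp_all)
    then have "?d x z + ?d y w \<le> max (?d x y + ?d z w) (?d y z + ?d x w) + 2 * \<delta>" using four by blast
    \<comment> \<open>Both smaller sums lie at least \<open>2 * m\<close> below the diagonal sum,
      which exceeds their maximum by at most \<open>2 * \<delta>\<close>.\<close>
    with le have "enn2real m \<le> \<delta>" by linarith
    then show "m \<le> ennreal \<delta>" using m' ennreal_leI by metis
  qed
  then have "box_constant \<mu> \<le> ennreal \<delta>" unfolding box_constant_def by (auto intro!: SUP_least)
  then show ?thesis using \<open>0 \<le> \<delta>\<close> enn2real_leI by blast
qed

theorem theorem1:
  fixes \<Gamma> :: "(complex \<Rightarrow> complex) set" and \<mu> :: "complex uprod measure"
  assumes "closed_hyperbolic_surface \<Gamma>"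
    and "geodesic_current \<Gamma> \<mu>"
  shows "box_constant \<mu> < \<infinity> \<and>
    hyperbolic_space (enn2real (box_constant \<mu>)) (dual_space \<mu>) (dual_dist \<mu>) \<and>
    (\<forall>\<delta>. hyperbolic_space \<delta> (dual_space \<mu>) (dual_dist \<mu>) \<longrightarrow> enn2real (box_constant \<mu>) \<le> \<delta>)"
  using box_constant_finite[OF assms] hyperbolic_space_dual[OF assms]
    box_constant_le_hyperbolicity[OF assms(2)] by blast

end
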